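(* Let $k \ge 11$ and let $R$ be a rainbow clique on $k$ vertices. Then $R$ is a fractalizer, and \[ \operatorname{ind}(R) = \frac{k!}{k^k-k}. \]
   Context: An edge-coloring of a complete graph $G$ is a function $\chi: E(G) \to T$ for a set $T$ of colors; $G$ is then $T$-colored. A colored complete graph is rainbow if its coloring is injective. Two colored complete graphs $G, H$ are isomorphic if there is a bijection $V(G)\to V(H)$ preserving the colors of all edges. For a $T$-colored complete graph $F$ on $k$ vertices and a $T$-colored complete graph $G$ on $n>k$ vertices, let $I(F,G)$ be the number of $k$-subsets $S\subseteq V(G)$ with $G[S]\cong F$ (as colored graphs), and $\varrho(F,G) = I(F,G)/\binom{n}{k}$. Let $I(F,n)$ be the maximum of $I(F,G)$ over all $T$-colored complete graphs $G$ on $n$ vertices, $\operatorname{ind}(F,n) = I(F,n)/\binom nk$ (a non-increasing sequence in $n$), and the inducibility $\operatorname{ind}(F) = \lim_{n\to\infty}\operatorname{ind}(F,n)$. Iterated balanced blow-up: label $V(F)=[k]$. Define families $\mathcal{G}_F(n)$ of $T$-colored complete graphs on $n$ vertices inductively: for $n<k$, $\mathcal{G}_F(n)$ consists of a $T$-colored complete graph on $n$ vertices (it contains no $k$-subsets, so its coloring is irrelevant); for $n \ge k$, $G \in \mathcal{G}_F(n)$ if there is a partition $V(G) = V_1\cup\cdots\cup V_k$ with $||V_i|-|V_j||\le 1$ for all $i,j$, $G[V_i]\in\mathcal{G}_F(|V_i|)$ for all $i$, and for $v\in V_i$, $w\in V_j$, $i\ne j$, the color of $vw$ in $G$ equals the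 color of $ij$ in $F$. $F$ is a fractalizer if $\operatorname{ind}(F) = \lim_{n\to\infty}\max_{G\in\mathcal{G}_F(n)}\varrho(F,G)$. *)

theory Defs
  imports Complex_Main "HOL-Library.Ramsey" "HOL-Library.Disjoint_Sets"
begin

text \<open>Edges are two-element vertex sets; the values of \<open>color\<close> on all other sets are irrelevant.\<close>

record ('v, 't) cgraph =
  verts :: "'v set"
  color :: "'v set \<Rightarrow> 't"

definition edges :: "('v, 't) cgraph \<Rightarrow> 'v set set" where
  "edges G = nsets (verts G) 2"

definition num_verts :: "('v, 't) cgraph \<Rightarrow> nat" where
  "num_verts G = card (verts G)"

definition colored_complete :: "'t set \<Rightarrow> ('v, 't) cgraph \<Rightarrow> bool" where
  "colored_complete T G \<longleftrightarrow> finite (verts G) \<and> (\<forall>e\<in>edges G. color G e \<in> T)"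

definition rainbow :: "('v, 't) cgraph \<Rightarrow> bool" where
  "rainbow G \<longleftrightarrow> inj_on (color G) (edges G)"

definition cgraph_iso :: "('v, 't) cgraph \<Rightarrow> ('w, 't) cgraph \<Rightarrow> bool" where
  "cgraph_iso G H \<longleftrightarrow>
     (\<exists>f. bij_betw f (verts G) (verts H) \<and> (\<forall>e\<in>edges G. color H (f ` e) = color G e))"

definition induced :: "('v, 't) cgraph \<Rightarrow> 'v set \<Rightarrow> ('v, 't) cgraph" where
  "induced G S = \<lparr>verts = S, color = color G\<rparr>"

definition copies :: "('a, 't) cgraph \<Rightarrow> ('v, 't) cgraph \<Rightarrow> nat" where
  "copies F G = card {S \<in> nsets (verts G) (num_verts F). cgraph_iso (induced G S) F}"

definition copy_density :: "('a, 't) cgraph \<Rightarrow> ('v, 't) cgraph \<Rightarrow> real" where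
  "copy_density F G = real (copies F G) / real (num_verts G choose num_verts F)"

text \<open>Every finite graph is isomorphic to one whose vertices are natural numbers, so host graphs are
  taken with vertices in \<open>nat\<close>. The numbers of copies are at most \<open>n choose num_verts F\<close>, so the maximum
  is over a finite set even if \<open>T\<close> is infinite.\<close>

definition max_copies :: "'t set \<Rightarrow> ('a, 't) cgraph \<Rightarrow> nat \<Rightarrow> nat" where
  "max_copies T F n =
     Max {copies F G |G :: (nat, 't) cgraph. colored_complete T G \<and> num_verts G = n}"

definition ind_n :: "'t set \<Rightarrow> ('a, 't) cgraph \<Rightarrow> nat \<Rightarrow> real" where
  "ind_n T F n = real (max_copies T F n) / real (n choose num_verts F)"

definition inducibility :: "'t set \<Rightarrow> ('a, 't) cgraph \<Rightarrow> real" where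
  "inducibility T F = lim (ind_n T F)"

text \<open>The parts of the blow-up are indexed by the vertices of \<open>F\<close> themselves instead of by a labelling
  of them. Below \<open>num_verts F\<close> vertices, every \<open>T\<close>-coloring is admitted. The inductive definition is the
  recursion on the number of vertices whenever \<open>num_verts F \<ge> 2\<close>, as all parts are then
  strictly smaller than the whole.\<close>

inductive iterated_blowup :: "'t set \<Rightarrow> ('a, 't) cgraph \<Rightarrow> ('v, 't) cgraph \<Rightarrow> bool"
  for T :: "'t set" and F :: "('a, 't) cgraph"
where
  small: "\<lbrakk>colored_complete T G; num_verts G < num_verts F\<rbrakk> \<Longrightarrow> iterated_blowup T F G"
| blowup: "\<lbrakk>colored_complete T G; num_verts F \<le> num_verts G;
     verts G = (\<Union>i\<in>verts F. V i); disjoint_family_on V (verts F);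
     \<forall>i\<in>verts F. \<forall>j\<in>verts F. \<bar>int (card (V i)) - int (card (V j))\<bar> \<le> 1;
     \<forall>i\<in>verts F. iterated_blowup T F (induced G (V i));
     \<forall>i\<in>verts F. \<forall>j\<in>verts F. i \<noteq> j \<longrightarrow>
       (\<forall>v\<in>V i. \<forall>w\<in>V j. color G {v, w} = color F {i, j})\<rbrakk> \<Longrightarrow> iterated_blowup T F G"

text \<open>The limit is stated as convergence, because an equation between two values of \<open>lim\<close> would
  also hold if neither sequence converged.\<close>

definition fractalizer :: "'t set \<Rightarrow> ('a, 't) cgraph \<Rightarrow> bool" where
  "fractalizer T F \<longleftrightarrow>
     (\<lambda>n. Max {copy_density F G |G :: (nat, 't) cgraph. iterated_blowup T F G \<and> num_verts G = n})
       \<longlonglongrightarrow> inducibility T F"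

end

theory Submission
  imports Defs "HOL-Analysis.Convex"
begin

text \<open>Upper bound: every colored complete graph on \<open>n\<close> vertices contains at most \<open>n ^ k / (k ^ k - k)\<close>
  copies of \<open>R\<close>. In a minimal counterexample every vertex \<open>v\<close> lies in at least
  \<open>((n - 1) / k) ^ (k - 1)\<close> copies. The copies in which \<open>v\<close> plays the role \<open>a\<close> number at most the product
  over \<open>b\<close> of the degrees of \<open>v\<close> in the color of \<open>ab\<close>, so AM-GM gives \<open>v\<close> a dominant role \<open>i\<close>: at most
  \<open>2 (n - 1) / k\<close> edges at \<open>v\<close> have the color of an edge of \<open>R\<close> that avoids \<open>i\<close>. Partition the vertices
  by dominant role. A copy that contains no wrongly colored edge between different parts is either a
  transversal or inside one part. A wrongly colored edge forces one of its ends into a non-dominant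
  role, so it lies in very few copies, fewer than the transversals that it destroys even after
  division by \<open>k choose 2\<close>, the number of edges in a transversal. Hence the copies number at most the
  product of the part sizes plus the copies inside the parts, and the induction closes by
  \<open>(k ^ k - k) p\<^sub>1 \<dots> p\<^sub>k + \<Sum> p\<^sub>i ^ k \<le> (\<Sum> p\<^sub>i) ^ k\<close>, which is AM-GM applied to the \<open>k ^ k - k\<close> monomials
  of the right-hand side that are not powers of a single \<open>p\<^sub>i\<close>.

  Lower bound: iterated balanced blow-ups have at least \<open>n ^ k / (k ^ k - k) - n ^ (k - 1)\<close> copies, where
  \<open>n ^ (k - 1)\<close> absorbs the rounding of the part sizes.\<close>

section \<open>Inequalities\<close>

lemma prod_le_mean_power:
  fixes x :: "'a \<Rightarrow> real"
  assumes "finite S" and nonneg: "\<And>i. i \<in> S \<Longrightarrow> 0 \<le> x i"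
  shows "(\<Prod>i\<in>S. x i) \<le> ((\<Sum>i\<in>S. x i) / card S) ^ card S"
proof (cases "S = {}")
  case False
  have pos: "card S > 0" using assms False by (simp add: card_gt_0_iff)
  have prod_nonneg: "0 \<le> (\<Prod>i\<in>S. x i)" using nonneg by (simp add: prod_nonneg)
  have "(\<Prod>i\<in>S. x i) powr (1 / card S) \<le> (\<Sum>i\<in>S. x i) / card S"
    using arith_geom_mean[OF \<open>finite S\<close> False nonneg] by (simp add: sum_divide_distrib)
  then have "((\<Prod>i\<in>S. x i) powr (1 / card S)) ^ card S \<le> ((\<Sum>i\<in>S. x i) / card S) ^ card S"
    by (intro power_mono) auto
  moreover have "((\<Prod>i\<in>S. x i) powr (1 / card S)) ^ card S = (\<Prod>i\<in>S. x i)"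
    using pos prod_nonneg
    by (cases "(\<Prod>i\<in>S. x i) = 0") (simp_all add: powr_realpow[symmetric] powr_powr)
  ultimately show ?thesis by simp
qed simp

lemma card_PiE_fixed:
  assumes "finite K" "a \<in> K" "j \<in> A"
  shows "card {f \<in> K \<rightarrow>\<^sub>E A. f a = j} = card A ^ (card K - 1)"
proof -
  have "{f \<in> K \<rightarrow>\<^sub>E A. f a = j} = (\<Pi>\<^sub>E b\<in>K. if b = a then {j} else A)"
    using assms by (auto simp: PiE_iff extensional_def split: if_splits)
  then show ?thesis using assms by (simp add: card_PiE prod.remove[of K a])
qed

lemma prod_PiE_component:
  fixes x :: "'b \<Rightarrow> 'c::comm_semiring_1"
  assumes "finite K" "finite A" "a \<in> K"
  shows "(\<Prod>f\<in>K \<rightarrow>\<^sub>E A. x (f a)) = (\<Prod>j\<in>A. x j) ^ (card A ^ (card K - 1))"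
proof -
  have "(\<Prod>f\<in>K \<rightarrow>\<^sub>E A. x (f a)) = (\<Prod>j\<in>A. \<Prod>f\<in>{f \<in> K \<rightarrow>\<^sub>E A. f a = j}. x (f a))"
    using assms by (intro prod.group[symmetric]) (auto intro!: finite_PiE)
  also have "\<dots> = (\<Prod>j\<in>A. x j ^ (card A ^ (card K - 1)))"
    using assms by (intro prod.cong) (simp_all add: card_PiE_fixed)
  finally show ?thesis by (simp only: prod_power_distrib)
qed

definition constant_maps :: "'a set \<Rightarrow> ('a \<Rightarrow> 'a) set" where
  "constant_maps K = (\<lambda>j. \<lambda>_\<in>K. j) ` K"

lemma inj_on_constant_maps: "inj_on (\<lambda>j. \<lambda>_\<in>K. j) K"
  by (rule inj_onI) (metis restrict_apply')

lemma card_constant_maps: "card (constant_maps K) = card K"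
  by (simp add: constant_maps_def card_image inj_on_constant_maps)

lemma constant_maps_subset: "constant_maps K \<subseteq> K \<rightarrow>\<^sub>E K"
  by (auto simp: constant_maps_def)

lemma power_sum_eq_nonconstant_monomials:
  fixes p :: "'a \<Rightarrow> real"
  assumes "finite K"
  shows "(\<Sum>i\<in>K. p i) ^ card K =
    (\<Sum>i\<in>K. p i ^ card K) + (\<Sum>f\<in>(K \<rightarrow>\<^sub>E K) - constant_maps K. \<Prod>a\<in>K. p (f a))"
proof -
  have "(\<Sum>i\<in>K. p i) ^ card K = (\<Prod>a\<in>K. \<Sum>i\<in>K. p i)" by simp
  also have "\<dots> = (\<Sum>f\<in>K \<rightarrow>\<^sub>E K. \<Prod>a\<in>K. p (f a))"
    using assms by (intro prod_sum_PiE) auto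
  also have "\<dots> = (\<Sum>f\<in>constant_maps K. \<Prod>a\<in>K. p (f a))
      + (\<Sum>f\<in>(K \<rightarrow>\<^sub>E K) - constant_maps K. \<Prod>a\<in>K. p (f a))"
    using assms by (metis add.commute constant_maps_subset finite_PiE sum.subset_diff)
  also have "(\<Sum>f\<in>constant_maps K. \<Prod>a\<in>K. p (f a)) = (\<Sum>i\<in>K. p i ^ card K)"
    by (simp add: constant_maps_def sum.reindex[OF inj_on_constant_maps])
  finally show ?thesis .
qed

lemma prod_nonconstant_monomials:
  fixes p :: "'a \<Rightarrow> real"
  assumes "finite K" "K \<noteq> {}" and pos: "\<And>i. i \<in> K \<Longrightarrow> 0 < p i"
  shows "(\<Prod>f\<in>(K \<rightarrow>\<^sub>E K) - constant_maps K. \<Prod>a\<in>K. p (f a))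
    = (\<Prod>i\<in>K. p i) ^ (card K ^ card K - card K)"
proof -
  have "card K > 0" using assms by (simp add: card_gt_0_iff)
  have "(\<Prod>f\<in>K \<rightarrow>\<^sub>E K. \<Prod>a\<in>K. p (f a)) = (\<Prod>a\<in>K. \<Prod>f\<in>K \<rightarrow>\<^sub>E K. p (f a))" by (rule prod.swap)
  also have "\<dots> = ((\<Prod>i\<in>K. p i) ^ (card K ^ (card K - 1))) ^ card K"
    using assms(1) by (simp add: prod_PiE_component)
  also have "\<dots> = (\<Prod>i\<in>K. p i) ^ (card K ^ card K)"
    using \<open>card K > 0\<close> by (simp only: power_minus_mult flip: power_mult)
  finally have prod_all: "(\<Prod>f\<in>K \<rightarrow>\<^sub>E K. \<Prod>a\<in>K. p (f a)) = (\<Prod>i\<in>K. p i) ^ (card K ^ card K)" .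
  have prod_constants: "(\<Prod>f\<in>constant_maps K. \<Prod>a\<in>K. p (f a)) = (\<Prod>i\<in>K. p i) ^ card K"
    by (simp add: constant_maps_def prod.reindex[OF inj_on_constant_maps] prod_power_distrib)
  have nonzero: "(\<Prod>i\<in>K. p i) \<noteq> 0" using assms(1) pos by (force simp: prod_zero_iff)
  have "card K \<le> card K ^ card K" using \<open>card K > 0\<close> by (simp add: self_le_power)
  moreover have "(\<Prod>f\<in>K \<rightarrow>\<^sub>E K. \<Prod>a\<in>K. p (f a)) =
      (\<Prod>f\<in>(K \<rightarrow>\<^sub>E K) - constant_maps K. \<Prod>a\<in>K. p (f a)) * (\<Prod>f\<in>constant_maps K. \<Prod>a\<in>K. p (f a))"
    using assms(1) by (intro prod.subset_diff constant_maps_subset finite_PiE) auto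
  ultimately show ?thesis using nonzero unfolding prod_all prod_constants by (simp add: power_diff)
qed

lemma prod_plus_sum_powers_le_power_sum:
  fixes p :: "'a \<Rightarrow> real"
  assumes "finite K" "K \<noteq> {}" and nonneg: "\<And>i. i \<in> K \<Longrightarrow> 0 \<le> p i"
  shows "(real (card K) ^ card K - real (card K)) * (\<Prod>i\<in>K. p i) + (\<Sum>i\<in>K. p i ^ card K)
    \<le> (\<Sum>i\<in>K. p i) ^ card K"
proof -
  let ?N = "(K \<rightarrow>\<^sub>E K) - constant_maps K"
  define w where "w f = (\<Prod>a\<in>K. p (f a))" for f
  have w_nonneg: "0 \<le> w f" if "f \<in> ?N" for f
    using that nonneg by (auto simp: w_def intro!: prod_nonneg)
  have "card K \<le> card K ^ card K" using assms by (simp add: self_le_power Suc_leI card_gt_0_iff)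
  moreover have card_nonconstant: "card ?N = card K ^ card K - card K"
    using assms(1) constant_maps_subset[of K]
    by (simp add: card_Diff_subset finite_subset finite_PiE card_constant_maps card_PiE)
  ultimately have real_card: "real (card ?N) = real (card K) ^ card K - real (card K)"
    by (simp add: of_nat_diff)
  have "real (card ?N) * (\<Prod>i\<in>K. p i) \<le> (\<Sum>f\<in>?N. w f)"
  proof (cases "card ?N = 0 \<or> (\<exists>i\<in>K. p i = 0)")
    case True
    then have "real (card ?N) * (\<Prod>i\<in>K. p i) = 0" using assms(1) by auto
    then show ?thesis using w_nonneg by (simp only: sum_nonneg)
  next
    case False
    have "(\<Prod>i\<in>K. p i) ^ card ?N = (\<Prod>f\<in>?N. w f)"
      using False nonneg prod_nonconstant_monomials[OF assms(1,2), of p]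
      by (simp add: w_def card_nonconstant less_le)
    also have "\<dots> \<le> ((\<Sum>f\<in>?N. w f) / card ?N) ^ card ?N"
      using assms(1) w_nonneg by (intro prod_le_mean_power finite_Diff finite_PiE) auto
    finally have "(\<Prod>i\<in>K. p i) \<le> (\<Sum>f\<in>?N. w f) / card ?N"
      using False nonneg w_nonneg
      by (subst (asm) power_mono_iff) (auto intro!: prod_nonneg sum_nonneg divide_nonneg_nonneg)
    then show ?thesis using False by (simp add: pos_le_divide_eq mult.commute del: card_eq_0_iff)
  qed
  then show ?thesis
    using power_sum_eq_nonconstant_monomials[OF assms(1), of p] by (simp add: real_card w_def)
qed

lemma Bernoulli_homogeneous:
  fixes x y :: real
  assumes "0 \<le> x" "- x \<le> y"
  shows "x ^ k + real k * x ^ (k - 1) * y \<le> (x + y) ^ k"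
proof (cases "x = 0 \<or> k = 0")
  case True
  consider "k = 0" | "k = 1" | "k \<ge> 2" by linarith
  then show ?thesis using True assms by cases (auto simp: power_0_left)
next
  case False
  have "x ^ k * (1 + real k * (y / x)) \<le> x ^ k * (1 + y / x) ^ k"
    using assms False by (intro mult_left_mono Bernoulli_inequality) (auto simp: field_simps)
  also have "\<dots> = (x + y) ^ k" using False by (simp add: distrib_left flip: power_mult_distrib)
  also have "x ^ k * (1 + real k * (y / x)) = x ^ k + real k * x ^ (k - 1) * y"
    using False by (simp add: power_eq_if[of x k] field_simps)
  finally show ?thesis .
qed

lemma Bernoulli_second_order:
  fixes x :: real
  assumes "x \<ge> 0"
  shows "1 + real m * x + real m * (real m - 1) / 2 * x\<^sup>2 \<le> (1 + x) ^ m"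
proof (induction m)
  case (Suc m)
  have "0 \<le> real m * (real m - 1)" by (cases m) auto
  then have "0 \<le> real m * (real m - 1) / 2 * x ^ 3" using assms by simp
  then have "1 + real (Suc m) * x + real (Suc m) * (real (Suc m) - 1) / 2 * x\<^sup>2
    \<le> (1 + real m * x + real m * (real m - 1) / 2 * x\<^sup>2) * (1 + x)"
    by (simp add: field_simps power2_eq_square power3_eq_cube)
  also have "\<dots> \<le> (1 + x) ^ m * (1 + x)" using Suc assms by (intro mult_right_mono) auto
  finally show ?case by (simp add: mult.commute)
qed simp

lemma two_mult_le_power_self:
  assumes "k \<ge> 2"
  shows "2 * real k \<le> real k ^ k"
proof -
  have "2 * real k \<le> real k ^ 2" using assms by (simp add: power2_eq_square)
  also have "\<dots> \<le> real k ^ k" using assms by (intro power_increasing) auto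
  finally show ?thesis .
qed

lemma less_power_self: "k \<ge> 2 \<Longrightarrow> real k < real k ^ k"
  using two_mult_le_power_self[of k] by linarith

lemma two_mult_power_less:
  assumes "k \<ge> 7"
  shows "2 * real k * (real k - 2) ^ (k - 2) < (real k - 1) ^ (k - 1)"
proof -
  define q where "q = k - 2"
  have k_eq: "k = q + 2" and q_ge: "q \<ge> 5" using assms by (auto simp: q_def)
  have "5 * real q \<le> real q * real q" using q_ge by (intro mult_right_mono) auto
  then have quadratic: "4 * real q < real q * real q - 1" using q_ge by linarith
  have "1 + real q * (1 / real q) + real q * (real q - 1) / 2 * (1 / real q)\<^sup>2
      = 2 + (real q - 1) / (2 * real q)"
    using q_ge by (simp add: power2_eq_square)
  then have "2 + (real q - 1) / (2 * real q) \<le> (1 + 1 / real q) ^ q"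
    using Bernoulli_second_order[of "1 / real q" q] by simp
  then have "real q ^ q * (2 + (real q - 1) / (2 * real q)) \<le> real q ^ q * (1 + 1 / real q) ^ q"
    by (intro mult_left_mono) auto
  also have "\<dots> = (real q + 1) ^ q"
    using q_ge by (simp add: power_mult_distrib[symmetric] field_simps)
  finally have "(real q + 1) * (real q ^ q * (2 + (real q - 1) / (2 * real q)))
    \<le> (real q + 1) * (real q + 1) ^ q"
    by (intro mult_left_mono) auto
  moreover have "2 * (real q + 2) < (real q + 1) * (2 + (real q - 1) / (2 * real q))"
    using quadratic q_ge by (simp add: field_simps)
  then have "2 * (real q + 2) * real q ^ q
      < (real q + 1) * (2 + (real q - 1) / (2 * real q)) * real q ^ q"
    using q_ge by (intro mult_strict_right_mono) auto
  ultimately show ?thesis by (simp add: k_eq algebra_simps)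
qed

lemma quintic_mult_power_two_le_power_self:
  fixes m :: nat
  assumes "m \<ge> 8"
  shows "(m + 3) ^ 4 * (m + 2) * 2 ^ m \<le> 3 * m ^ m"
  using assms
proof (induction m rule: dec_induct)
  case (step m)
  obtain j where m_eq: "m = 8 + j" using step.hyps(1) le_Suc_ex by blast
  have "2 * (m + 4) ^ 4 * (m + 3) \<le> (m + 1) * ((m + 3) ^ 4 * (m + 2))"
    by (simp add: m_eq algebra_simps power_numeral_reduce)
  then have "2 * (m + 4) ^ 4 * (m + 3) * 2 ^ m \<le> (m + 1) * ((m + 3) ^ 4 * (m + 2)) * 2 ^ m"
    by (rule mult_right_mono) simp
  also have "\<dots> = (m + 1) * ((m + 3) ^ 4 * (m + 2) * 2 ^ m)" by (simp only: mult.assoc)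
  also have "\<dots> \<le> (m + 1) * (3 * m ^ m)" by (rule mult_left_mono[OF step.IH]) simp
  also have "\<dots> \<le> (m + 1) * (3 * (m + 1) ^ m)" by (intro mult_left_mono power_mono) auto
  finally have "2 * (m + 4) ^ 4 * (m + 3) * 2 ^ m \<le> (m + 1) * (3 * (m + 1) ^ m)" .
  moreover have "Suc m + 3 = m + 4" "Suc m + 2 = m + 3" "Suc m = m + 1" by simp_all
  ultimately show ?case by (simp only: power_add power_one_right mult_ac)
qed simp

lemma wrong_pair_factor_le:
  assumes "k \<ge> 11"
  shows "real k * (real k - 1) * (2 / (real k * (real k - 3))) ^ (k - 3) \<le> 3 / real k ^ k"
proof -
  define m where "m = k - 3"
  have k_eq: "k = m + 3" and m_ge: "m \<ge> 8" using assms by (auto simp: m_def)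
  have "real ((m + 3) ^ 4 * (m + 2) * 2 ^ m) \<le> real (3 * m ^ m)"
    using quintic_mult_power_two_le_power_self[OF m_ge] of_nat_le_iff by blast
  then have "(real m + 3) ^ 4 * (real m + 2) * 2 ^ m \<le> 3 * real m ^ m"
    by (simp only: of_nat_mult of_nat_power of_nat_add of_nat_numeral)
  then have "(real m + 3) * (real m + 2) * 2 ^ m * (real m + 3) ^ 3 \<le> 3 * real m ^ m"
    by (simp add: power_numeral_reduce mult_ac)
  then have "(real m + 3) ^ m * ((real m + 3) * (real m + 2) * 2 ^ m * (real m + 3) ^ 3)
      \<le> (real m + 3) ^ m * (3 * real m ^ m)"
    by (intro mult_left_mono) auto
  then show ?thesis using m_ge
    by (simp add: k_eq power_divide power_mult_distrib power_add power2_eq_square divide_simps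
        mult_ac add_ac)
qed

lemma wrong_role_factor_le:
  assumes "k \<ge> 11"
  shows "(2 / (real k * (real k - 2))) ^ (k - 2) \<le> 1 / (4 * real k ^ k)"
proof -
  define y where "y = (2 / (real k * (real k - 3))) ^ (k - 3)"
  have "k - 2 = Suc (k - 3)" using assms by simp
  then have "(2 / (real k * (real k - 2))) ^ (k - 2)
      = 2 / (real k * (real k - 2)) * (2 / (real k * (real k - 2))) ^ (k - 3)" by simp
  also have "\<dots> \<le> 1 / 12 * y"
  proof (unfold y_def, intro mult_mono power_mono divide_left_mono)
    have "24 \<le> real k * (real k - 2)" using mult_mono[of 11 "real k" 9 "real k - 2"] assms by simp
    then show "2 / (real k * (real k - 2)) \<le> 1 / 12" by (simp add: divide_simps)
  qed (use assms in auto)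
  finally have "(2 / (real k * (real k - 2))) ^ (k - 2) \<le> 1 / 12 * y" .
  moreover have "1 * y \<le> real k * (real k - 1) * y"
  proof (rule mult_right_mono)
    show "1 \<le> real k * (real k - 1)" using mult_mono[of 1 "real k" 1 "real k - 1"] assms by simp
    show "0 \<le> y" using assms by (simp add: y_def)
  qed
  ultimately show ?thesis using wrong_pair_factor_le[OF assms] unfolding y_def by simp
qed

lemma two_mult_plus_power_two_le:
  assumes "k \<ge> 4"
  shows "2 * real k + real k * 2 ^ (k - 1) \<le> real k ^ (k - 1)"
proof -
  define m where "m = k - 2"
  have k_eq: "k = m + 2" and m_ge: "m \<ge> 2" using assms by (auto simp: m_def)
  have four_le: "(2::real) ^ 2 \<le> 2 ^ m" using m_ge by (intro power_increasing) auto
  then have "2 ^ m * 4 \<le> 2 ^ m * (2::real) ^ m" by (intro mult_left_mono) auto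
  also have "\<dots> = 4 ^ m" by (simp flip: power_mult_distrib)
  also have "\<dots> \<le> real k ^ m" using assms by (intro power_mono) auto
  finally have "2 + 2 ^ (m + 1) \<le> real k ^ m" using four_le by simp
  then have "real k * (2 + 2 ^ (m + 1)) \<le> real k * real k ^ m" by (rule mult_left_mono) simp
  then show ?thesis by (simp add: k_eq algebra_simps)
qed

section \<open>The fractal bound\<close>

definition fractal_bound :: "nat \<Rightarrow> real \<Rightarrow> real" where
  "fractal_bound k x = x ^ k / (real k ^ k - real k)"

lemma power_le_fractal_bound:
  assumes "k \<ge> 2" "x \<ge> 0"
  shows "(x / real k) ^ k \<le> fractal_bound k x"
  unfolding fractal_bound_def power_divide
  using assms less_power_self[OF assms(1)] by (intro divide_left_mono) auto

lemma fractal_bound_mono: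
  assumes "k \<ge> 2" "0 \<le> x" "x \<le> y"
  shows "fractal_bound k x \<le> fractal_bound k y"
  unfolding fractal_bound_def
  using assms less_power_self[OF assms(1)] by (intro divide_right_mono power_mono) auto

lemma fractal_bound_plus_one_ge:
  assumes "k \<ge> 2" "x \<ge> 0"
  shows "fractal_bound k x + (x / real k) ^ (k - 1) \<le> fractal_bound k (x + 1)"
proof -
  define D where "D = real k ^ k - real k"
  have D_pos: "D > 0" using less_power_self[OF assms(1)] by (simp add: D_def)
  have "(x / real k) ^ (k - 1) = real k * x ^ (k - 1) / real k ^ k"
    using assms(1) by (simp add: power_divide power_eq_if[of "real k" k])
  also have "\<dots> \<le> real k * x ^ (k - 1) / D"
    using D_pos assms by (intro divide_left_mono) (auto simp: D_def)
  finally have "x ^ k / D + (x / real k) ^ (k - 1) \<le> (x ^ k + real k * x ^ (k - 1)) / D"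
    by (simp add: add_divide_distrib)
  also have "\<dots> \<le> (x + 1) ^ k / D"
    using Bernoulli_homogeneous[of x 1 k] D_pos assms by (intro divide_right_mono) auto
  finally show ?thesis by (simp add: fractal_bound_def D_def)
qed

lemma prod_plus_sum_fractal_bound_le:
  fixes p :: "'a \<Rightarrow> real"
  assumes "finite K" "card K \<ge> 2" and "\<And>i. i \<in> K \<Longrightarrow> 0 \<le> p i"
  shows "(\<Prod>i\<in>K. p i) + (\<Sum>i\<in>K. fractal_bound (card K) (p i)) \<le> fractal_bound (card K) (\<Sum>i\<in>K. p i)"
proof -
  define D where "D = real (card K) ^ card K - real (card K)"
  have D_pos: "D > 0" using less_power_self[OF assms(2)] by (simp add: D_def)
  have "K \<noteq> {}" using assms(2) by auto
  then have "D * (\<Prod>i\<in>K. p i) + (\<Sum>i\<in>K. p i ^ card K) \<le> (\<Sum>i\<in>K. p i) ^ card K"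
    unfolding D_def using assms by (intro prod_plus_sum_powers_le_power_sum)
  then have "(D * (\<Prod>i\<in>K. p i) + (\<Sum>i\<in>K. p i ^ card K)) / D \<le> (\<Sum>i\<in>K. p i) ^ card K / D"
    using D_pos by (intro divide_right_mono) auto
  then show ?thesis
    using D_pos
    by (simp add: fractal_bound_def D_def[symmetric] add_divide_distrib sum_divide_distrib)
qed

section \<open>Edge weights on a complete graph\<close>

definition weighted_degree :: "'a set \<Rightarrow> ('a set \<Rightarrow> 'b::comm_monoid_add) \<Rightarrow> 'a \<Rightarrow> 'b" where
  "weighted_degree K x a = (\<Sum>b\<in>K - {a}. x {a, b})"

lemma weighted_degree_eq_sum_nsets:
  assumes "a \<in> K"
  shows "weighted_degree K x a = (\<Sum>e\<in>{e \<in> nsets K 2. a \<in> e}. x e)"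
proof -
  have inj: "inj_on (\<lambda>b. {a, b}) (K - {a})" by (auto simp: inj_on_def doubleton_eq_iff)
  have "{e \<in> nsets K 2. a \<in> e} = (\<lambda>b. {a, b}) ` (K - {a})"
    using assms by (auto simp: nsets_2_eq)
  then show ?thesis by (simp add: weighted_degree_def sum.reindex[OF inj])
qed

lemma sum_nsets_eq_weighted_degree_plus:
  assumes "finite K" "a \<in> K"
  shows "(\<Sum>e\<in>nsets K 2. x e) = weighted_degree K x a + (\<Sum>e\<in>{e \<in> nsets K 2. a \<notin> e}. x e)"
proof -
  have "nsets K 2 = {e \<in> nsets K 2. a \<in> e} \<union> {e \<in> nsets K 2. a \<notin> e}" by auto
  then have "(\<Sum>e\<in>nsets K 2. x e)
      = (\<Sum>e\<in>{e \<in> nsets K 2. a \<in> e}. x e) + (\<Sum>e\<in>{e \<in> nsets K 2. a \<notin> e}. x e)"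
    using assms by (subst sum.union_disjoint[symmetric]) (auto simp: finite_imp_finite_nsets)
  then show ?thesis using assms by (simp add: weighted_degree_eq_sum_nsets)
qed

lemma sum_weighted_degree:
  fixes x :: "'a set \<Rightarrow> 'b::comm_semiring_1"
  assumes "finite K"
  shows "(\<Sum>a\<in>K. weighted_degree K x a) = 2 * (\<Sum>e\<in>nsets K 2. x e)"
proof -
  have "(\<Sum>a\<in>K. weighted_degree K x a) = (\<Sum>a\<in>K. \<Sum>e\<in>{e \<in> nsets K 2. a \<in> e}. x e)"
    by (simp add: weighted_degree_eq_sum_nsets)
  also have "\<dots> = (\<Sum>e\<in>nsets K 2. \<Sum>a\<in>{a \<in> K. a \<in> e}. x e)"
    using assms by (intro sum.swap_restrict finite_imp_finite_nsets)
  also have "\<dots> = (\<Sum>e\<in>nsets K 2. 2 * x e)"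
  proof (intro sum.cong refl)
    fix e assume e: "e \<in> nsets K 2"
    then have "{a \<in> K. a \<in> e} = e" by (auto simp: nsets_def)
    with e show "(\<Sum>a\<in>{a \<in> K. a \<in> e}. x e) = 2 * x e" by (simp add: nsets_def)
  qed
  finally show ?thesis by (simp add: sum_distrib_left)
qed

lemma sum_prod_incident_le:
  fixes x :: "'a set \<Rightarrow> real"
  assumes fin: "finite K" and card_ge: "card K \<ge> 2" and nonneg: "\<And>e. 0 \<le> x e"
    and degree_le: "\<And>a. a \<in> K \<Longrightarrow> weighted_degree K x a \<le> M"
  shows "(\<Sum>a\<in>K. \<Prod>b\<in>K - {a}. x {a, b})
    \<le> 2 * (\<Sum>e\<in>nsets K 2. x e) * M ^ (card K - 2) / (real (card K) - 1) ^ (card K - 1)"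
proof -
  let ?k = "card K"
  have pred_card: "?k - 1 = Suc (?k - 2)" using card_ge by simp
  have degree_nonneg: "0 \<le> weighted_degree K x a" for a
    using nonneg by (simp add: weighted_degree_def sum_nonneg)
  have "(\<Sum>a\<in>K. \<Prod>b\<in>K - {a}. x {a, b})
      \<le> (\<Sum>a\<in>K. weighted_degree K x a * M ^ (?k - 2) / (real ?k - 1) ^ (?k - 1))"
  proof (rule sum_mono)
    fix a assume a: "a \<in> K"
    have "(\<Prod>b\<in>K - {a}. x {a, b}) \<le> (weighted_degree K x a / (real ?k - 1)) ^ (?k - 1)"
      using prod_le_mean_power[of "K - {a}" "\<lambda>b. x {a, b}"] fin a card_ge nonneg
      by (simp add: weighted_degree_def of_nat_diff)
    also have "\<dots> =
        weighted_degree K x a * weighted_degree K x a ^ (?k - 2) / (real ?k - 1) ^ (?k - 1)"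
      by (simp only: pred_card power_divide power_Suc times_divide_times_eq)
    also have "\<dots> \<le> weighted_degree K x a * M ^ (?k - 2) / (real ?k - 1) ^ (?k - 1)"
      using degree_le[OF a] degree_nonneg card_ge
      by (intro divide_right_mono mult_left_mono power_mono) auto
    finally show "(\<Prod>b\<in>K - {a}. x {a, b})
      \<le> weighted_degree K x a * M ^ (?k - 2) / (real ?k - 1) ^ (?k - 1)" .
  qed
  also have "\<dots> = (\<Sum>a\<in>K. weighted_degree K x a) * M ^ (?k - 2) / (real ?k - 1) ^ (?k - 1)"
    by (simp add: sum_distrib_right sum_divide_distrib)
  finally show ?thesis by (simp add: sum_weighted_degree[OF fin])
qed

lemma ex_large_weighted_degree:
  fixes x :: "'a set \<Rightarrow> real"
  assumes fin: "finite K" and card_ge: "card K \<ge> 7" and nonneg: "\<And>e. 0 \<le> x e"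
    and total: "(\<Sum>e\<in>nsets K 2. x e) \<le> N"
    and large: "(N / real (card K)) ^ (card K - 1) \<le> (\<Sum>a\<in>K. \<Prod>b\<in>K - {a}. x {a, b})"
  shows "\<exists>i\<in>K. N * (1 - 2 / real (card K)) \<le> weighted_degree K x i"
proof (rule ccontr)
  assume contra: "\<not> ?thesis"
  then have small: "weighted_degree K x a \<le> N * (1 - 2 / real (card K))" if "a \<in> K" for a
    using that by fastforce
  let ?k = "card K"
  define M where "M = N * (1 - 2 / real ?k)"
  have pred_card: "?k - 1 = Suc (?k - 2)" using card_ge by simp
  have "K \<noteq> {}" using card_ge by auto
  then obtain a where a_small: "a \<in> K" "weighted_degree K x a < M"
    using contra by (auto simp: M_def not_le)
  have "0 \<le> weighted_degree K x a" using nonneg by (simp add: weighted_degree_def sum_nonneg)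
  with a_small have "0 < M" by linarith
  then have N_pos: "N > 0" using card_ge by (simp add: M_def zero_less_mult_iff)
  have "(N / real ?k) ^ (?k - 1)
      \<le> 2 * (\<Sum>e\<in>nsets K 2. x e) * M ^ (?k - 2) / (real ?k - 1) ^ (?k - 1)"
    using large sum_prod_incident_le[OF fin _ nonneg small] card_ge by (simp add: M_def)
  also have "\<dots> \<le> 2 * N * M ^ (?k - 2) / (real ?k - 1) ^ (?k - 1)"
    using total card_ge \<open>0 < M\<close> by (intro divide_right_mono mult_right_mono mult_left_mono) auto
  also have "M ^ (?k - 2) = (N / real ?k) ^ (?k - 2) * (real ?k - 2) ^ (?k - 2)"
    using card_ge by (simp add: M_def power_mult_distrib[symmetric] field_simps)
  also have "2 * N * \<dots> / (real ?k - 1) ^ (?k - 1)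
      = (N / real ?k) ^ (?k - 1)
        * (2 * real ?k * (real ?k - 2) ^ (?k - 2) / (real ?k - 1) ^ (?k - 1))"
  proof -
    have "2 * N * (P * Q) / d = (N / real ?k * P) * (2 * real ?k * Q / d)" for P Q d :: real
      using card_ge by auto
    then show ?thesis by (simp only: pred_card power_Suc)
  qed
  also have "\<dots> < (N / real ?k) ^ (?k - 1) * 1"
    using two_mult_power_less[OF card_ge] card_ge N_pos by (intro mult_strict_left_mono) auto
  finally show False by simp
qed

section \<open>Fibers and transversals\<close>

definition fiber :: "('a \<Rightarrow> 'b) \<Rightarrow> 'a set \<Rightarrow> 'b \<Rightarrow> 'a set" where
  "fiber f A i = {x \<in> A. f x = i}"

lemma fiber_subset: "fiber f A i \<subseteq> A"
  by (auto simp: fiber_def)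

lemma finite_fiber [simp]: "finite A \<Longrightarrow> finite (fiber f A i)"
  by (simp add: fiber_def)

lemma sum_card_fiber:
  assumes "finite A" "finite K" "f ` A \<subseteq> K"
  shows "(\<Sum>i\<in>K. card (fiber f A i)) = card A"
  using sum.group[OF assms, of "\<lambda>_. 1::nat"] by (simp add: fiber_def)

lemma prod_card_le_card_PiE_through_pair:
  assumes "finite K" and finite_W: "\<And>l. l \<in> K \<Longrightarrow> finite (W l)"
    and ij: "i \<in> K" "j \<in> K" "i \<noteq> j" and vw: "v \<in> W i" "w \<in> W j"
  shows "(\<Prod>l\<in>K - {i, j}. card (W l)) \<le> card {\<psi> \<in> Pi\<^sub>E K W. {v, w} \<subseteq> \<psi> ` K}"
proof -
  define U where "U = W(i := {v}, j := {w})"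
  have "(\<Prod>l\<in>K - {i, j}. card (W l)) = (\<Prod>l\<in>K. card (U l))"
    using assms by (intro prod.mono_neutral_cong_left) (auto simp: U_def)
  also have "\<dots> = card (Pi\<^sub>E K U)" using assms(1) by (simp add: card_PiE)
  also have "\<dots> \<le> card {\<psi> \<in> Pi\<^sub>E K W. {v, w} \<subseteq> \<psi> ` K}"
  proof (rule card_mono)
    show "finite {\<psi> \<in> Pi\<^sub>E K W. {v, w} \<subseteq> \<psi> ` K}" using assms(1) finite_W by (simp add: finite_PiE)
    have "U l \<subseteq> W l" if "l \<in> K" for l using vw by (simp add: U_def)
    then have "Pi\<^sub>E K U \<subseteq> Pi\<^sub>E K W" by (rule PiE_mono)
    moreover have "\<psi> i = v" "\<psi> j = w" if "\<psi> \<in> Pi\<^sub>E K U" for \<psi>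
      using PiE_mem[OF that ij(1)] PiE_mem[OF that ij(2)] ij(3) by (simp_all add: U_def)
    ultimately show "Pi\<^sub>E K U \<subseteq> {\<psi> \<in> Pi\<^sub>E K W. {v, w} \<subseteq> \<psi> ` K}" using ij by blast
  qed
  finally show ?thesis .
qed

lemma card_hitting_le_card_hitting:
  fixes hits :: "'a \<Rightarrow> 'e \<Rightarrow> bool" and hits' :: "'b \<Rightarrow> 'e \<Rightarrow> bool"
  assumes "finite M" "finite Q" "c > 0"
    and few: "\<And>e. e \<in> M \<Longrightarrow> c * card {x \<in> P. hits x e} \<le> card {y \<in> Q. hits' y e}"
    and bounded: "\<And>y. y \<in> Q \<Longrightarrow> card {e \<in> M. hits' y e} \<le> c"
  shows "card {x \<in> P. \<exists>e\<in>M. hits x e} \<le> card {y \<in> Q. \<exists>e\<in>M. hits' y e}"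
proof -
  have "{x \<in> P. \<exists>e\<in>M. hits x e} = (\<Union>e\<in>M. {x \<in> P. hits x e})" by auto
  then have "c * card {x \<in> P. \<exists>e\<in>M. hits x e} \<le> c * (\<Sum>e\<in>M. card {x \<in> P. hits x e})"
    using card_UN_le[OF assms(1), of "\<lambda>e. {x \<in> P. hits x e}"] by (intro mult_left_mono) auto
  also have "\<dots> = (\<Sum>e\<in>M. c * card {x \<in> P. hits x e})" by (rule sum_distrib_left)
  also have "\<dots> \<le> (\<Sum>e\<in>M. card {y \<in> Q. hits' y e})" by (intro sum_mono few)
  also have "\<dots> = (\<Sum>y\<in>Q. card {e \<in> M. hits' y e})"
    using sum.swap_restrict[OF assms(1,2), of "\<lambda>_ _. 1::nat" "\<lambda>e y. hits' y e"] by simp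
  also have "\<dots> = (\<Sum>y\<in>{y \<in> Q. \<exists>e\<in>M. hits' y e}. card {e \<in> M. hits' y e})"
    using assms(1,2) by (intro sum.mono_neutral_right) auto
  also have "\<dots> \<le> (\<Sum>y\<in>{y \<in> Q. \<exists>e\<in>M. hits' y e}. c)" by (intro sum_mono bounded) auto
  finally show ?thesis using \<open>c > 0\<close> by simp
qed

lemma constant_or_identity:
  assumes card_ge: "card K \<ge> 3" and maps: "\<And>a. a \<in> K \<Longrightarrow> \<sigma> a \<in> K"
    and fixes_pairs: "\<And>a b. a \<in> K \<Longrightarrow> b \<in> K \<Longrightarrow> \<sigma> a \<noteq> \<sigma> b \<Longrightarrow> {\<sigma> a, \<sigma> b} = {a, b}"
  shows "(\<exists>i\<in>K. \<forall>a\<in>K. \<sigma> a = i) \<or> (\<forall>a\<in>K. \<sigma> a = a)"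
proof (cases "\<exists>a\<in>K. \<exists>b\<in>K. \<sigma> a \<noteq> \<sigma> b")
  case True
  then obtain a b where ab: "a \<in> K" "b \<in> K" "\<sigma> a \<noteq> \<sigma> b" by blast
  have identity_at: "\<sigma> a = a \<and> \<sigma> b = b \<and> \<sigma> c = c" if "c \<in> K" "c \<noteq> a" "c \<noteq> b" for c
  proof (cases "\<sigma> c = \<sigma> a")
    case True
    then have "{\<sigma> c, \<sigma> b} = {c, b}" using fixes_pairs[of c b] ab that by simp
    then show ?thesis using fixes_pairs[OF ab] ab that True by (metis doubleton_eq_iff)
  next
    case False
    then have "{\<sigma> c, \<sigma> a} = {c, a}" using fixes_pairs[of c a] ab that by simp
    then show ?thesis using fixes_pairs[OF ab] ab that by (metis doubleton_eq_iff)
  qed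
  have "\<not> K \<subseteq> {a, b}" using card_ge card_mono[of "{a, b}" K] card_length[of "[a, b]"] by auto
  then show ?thesis using identity_at by blast
next
  case False
  moreover have "K \<noteq> {}" using card_ge by auto
  ultimately show ?thesis using maps by blast
qed

section \<open>Embeddings\<close>

lemma verts_induced [simp]: "verts (induced G S) = S"
  and color_induced [simp]: "color (induced G S) = color G"
  by (simp_all add: induced_def)

lemma doubleton_in_edges [simp]:
  "{v, w} \<in> edges G \<longleftrightarrow> v \<in> verts G \<and> w \<in> verts G \<and> v \<noteq> w"
  by (simp add: edges_def)

lemma finite_edges: "finite (verts G) \<Longrightarrow> finite (edges G)"
  by (simp add: edges_def finite_imp_finite_nsets)

definition embeddings :: "('a, 't) cgraph \<Rightarrow> ('v, 't) cgraph \<Rightarrow> ('a \<Rightarrow> 'v) set" where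
  "embeddings F G = {\<phi> \<in> verts F \<rightarrow>\<^sub>E verts G.
     inj_on \<phi> (verts F) \<and> (\<forall>e\<in>edges F. color G (\<phi> ` e) = color F e)}"

lemma embeddingsD:
  assumes "\<phi> \<in> embeddings F G"
  shows "a \<in> verts F \<Longrightarrow> \<phi> a \<in> verts G"
    and "a \<in> verts F \<Longrightarrow> b \<in> verts F \<Longrightarrow> a \<noteq> b \<Longrightarrow> \<phi> a \<noteq> \<phi> b"
    and "a \<in> verts F \<Longrightarrow> b \<in> verts F \<Longrightarrow> a \<noteq> b \<Longrightarrow> color G {\<phi> a, \<phi> b} = color F {a, b}"
proof -
  show "a \<in> verts F \<Longrightarrow> \<phi> a \<in> verts G" using assms by (auto simp: embeddings_def)
  show "a \<in> verts F \<Longrightarrow> b \<in> verts F \<Longrightarrow> a \<noteq> b \<Longrightarrow> \<phi> a \<noteq> \<phi> b"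
    using assms by (auto simp: embeddings_def inj_on_def)
  assume "a \<in> verts F" "b \<in> verts F" "a \<noteq> b"
  then have "{a, b} \<in> edges F" by simp
  then have "color G (\<phi> ` {a, b}) = color F {a, b}" using assms unfolding embeddings_def by blast
  then show "color G {\<phi> a, \<phi> b} = color F {a, b}" by simp
qed

lemma finite_embeddings: "finite (verts F) \<Longrightarrow> finite (verts G) \<Longrightarrow> finite (embeddings F G)"
  by (rule finite_subset[of _ "verts F \<rightarrow>\<^sub>E verts G"]) (auto simp: embeddings_def finite_PiE)

lemma embeddings_induced:
  assumes "U \<subseteq> verts G"
  shows "embeddings F (induced G U) = {\<phi> \<in> embeddings F G. \<phi> ` verts F \<subseteq> U}"
  using assms by (auto simp: embeddings_def PiE_iff subset_iff image_subset_iff)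

definition copy_sets :: "('a, 't) cgraph \<Rightarrow> ('v, 't) cgraph \<Rightarrow> 'v set set" where
  "copy_sets F G = {S \<in> nsets (verts G) (num_verts F). cgraph_iso (induced G S) F}"

lemma copies_eq_card_copy_sets: "copies F G = card (copy_sets F G)"
  by (simp add: copies_def copy_sets_def)

lemma image_embedding_in_copy_sets:
  assumes "finite (verts F)" and \<phi>: "\<phi> \<in> embeddings F G"
  shows "\<phi> ` verts F \<in> copy_sets F G"
proof -
  let ?K = "verts F"
  define f where "f = inv_into ?K \<phi>"
  have inj: "inj_on \<phi> ?K" using \<phi> by (simp add: embeddings_def)
  then have f_inverse: "bij_betw f (\<phi> ` ?K) ?K" "\<And>a. a \<in> ?K \<Longrightarrow> f (\<phi> a) = a"
    by (simp_all add: f_def inj_on_imp_bij_betw bij_betw_inv_into)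
  have "color F (f ` e) = color G e" if e: "e \<in> nsets (\<phi> ` ?K) 2" for e
  proof -
    obtain a b where "a \<in> ?K" "b \<in> ?K" "a \<noteq> b" "e = {\<phi> a, \<phi> b}"
      using e by (auto simp: nsets_2_eq)
    then show ?thesis using f_inverse(2) embeddingsD(3)[OF \<phi>] by simp
  qed
  then have "cgraph_iso (induced G (\<phi> ` ?K)) F"
    using f_inverse(1) by (auto simp: cgraph_iso_def edges_def)
  moreover have "\<phi> ` ?K \<subseteq> verts G" using embeddingsD(1)[OF \<phi>] by blast
  ultimately show ?thesis
    using card_image[OF inj] assms(1) by (simp add: copy_sets_def nsets_def num_verts_def)
qed

lemma copy_sets_subset_image_embeddings: "copy_sets F G \<subseteq> (\<lambda>\<phi>. \<phi> ` verts F) ` embeddings F G"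
proof
  let ?K = "verts F"
  fix S assume "S \<in> copy_sets F G"
  then obtain f where S_subset: "S \<subseteq> verts G" and f_bij: "bij_betw f S ?K"
    and color: "\<And>e. e \<in> nsets S 2 \<Longrightarrow> color F (f ` e) = color G e"
    by (auto simp: copy_sets_def cgraph_iso_def edges_def nsets_def)
  define \<phi> where "\<phi> = restrict (inv_into S f) ?K"
  have phi_bij: "bij_betw \<phi> ?K S"
    using bij_betw_inv_into[OF f_bij] by (rule bij_betw_cong[THEN iffD1, rotated]) (simp add: \<phi>_def)
  have "color G (\<phi> ` e) = color F e" if e: "e \<in> edges F" for e
  proof -
    obtain a b where ab: "a \<in> ?K" "b \<in> ?K" "a \<noteq> b" "e = {a, b}"
      using e by (auto simp: edges_def nsets_2_eq)
    then have "f (\<phi> a) = a" "f (\<phi> b) = b"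
      using f_bij by (simp_all add: \<phi>_def bij_betw_inv_into_right)
    moreover have "{\<phi> a, \<phi> b} \<in> nsets S 2"
      using phi_bij ab by (auto simp: bij_betw_def inj_on_def)
    ultimately show ?thesis using color[of "{\<phi> a, \<phi> b}"] ab by simp
  qed
  then have "\<phi> \<in> embeddings F G"
    using phi_bij S_subset by (auto simp: embeddings_def bij_betw_def \<phi>_def)
  moreover have "S = \<phi> ` ?K" using phi_bij by (simp add: bij_betw_def)
  ultimately show "S \<in> (\<lambda>\<phi>. \<phi> ` ?K) ` embeddings F G" by blast
qed

lemma copies_le_card_embeddings:
  assumes "finite (verts F)" "finite (verts G)"
  shows "copies F G \<le> card (embeddings F G)"
  unfolding copies_eq_card_copy_sets
  using finite_embeddings[OF assms] copy_sets_subset_image_embeddings by (rule surj_card_le)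

definition color_degree :: "('v, 't) cgraph \<Rightarrow> 'v \<Rightarrow> 't \<Rightarrow> nat" where
  "color_degree G v c = card {w \<in> verts G - {v}. color G {v, w} = c}"

lemma sum_color_degree_le:
  assumes "finite (verts G)" "v \<in> verts G" "finite C"
  shows "(\<Sum>c\<in>C. color_degree G v c) \<le> num_verts G - 1"
proof -
  have "(\<Sum>c\<in>C. color_degree G v c) = card (\<Union>c\<in>C. {w \<in> verts G - {v}. color G {v, w} = c})"
    unfolding color_degree_def using assms by (intro card_UN_disjoint[symmetric]) auto
  also have "\<dots> \<le> card (verts G - {v})" using assms by (intro card_mono) auto
  finally show ?thesis using assms by (simp add: num_verts_def)
qed

lemma card_embeddings_extending_le:
  assumes "finite (verts F)" "finite (verts G)" "A \<subseteq> verts F" "a \<in> A"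
  shows "card {\<phi> \<in> embeddings F G. \<forall>x\<in>A. \<phi> x = \<psi> x}
    \<le> (\<Prod>c\<in>verts F - A. color_degree G (\<psi> a) (color F {a, c}))"
proof -
  define X where "X = {\<phi> \<in> embeddings F G. \<forall>x\<in>A. \<phi> x = \<psi> x}"
  define nbhd where "nbhd c = {w \<in> verts G - {\<psi> a}. color G {\<psi> a, w} = color F {a, c}}" for c
  have "inj_on (\<lambda>\<phi>. restrict \<phi> (verts F - A)) X"
  proof (rule inj_onI, rule ext)
    fix \<phi> \<phi>' x
    assume eq: "\<phi> \<in> X" "\<phi>' \<in> X" "restrict \<phi> (verts F - A) = restrict \<phi>' (verts F - A)"
    consider "x \<notin> verts F" | "x \<in> A" | "x \<in> verts F - A" using assms by auto
    then show "\<phi> x = \<phi>' x"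
    proof cases
      case 1 with eq show ?thesis by (auto simp: X_def embeddings_def PiE_def extensional_def)
    next
      case 2 with eq show ?thesis by (auto simp: X_def)
    next
      case 3 with eq show ?thesis by (metis restrict_apply')
    qed
  qed
  moreover have "(\<lambda>\<phi>. restrict \<phi> (verts F - A)) ` X \<subseteq> (\<Pi>\<^sub>E c\<in>verts F - A. nbhd c)"
  proof (clarsimp simp: X_def)
    fix \<phi> c assume \<phi>: "\<phi> \<in> embeddings F G" "\<forall>x\<in>A. \<phi> x = \<psi> x" and c: "c \<in> verts F" "c \<notin> A"
    then have "a \<in> verts F" "a \<noteq> c" "\<psi> a = \<phi> a" using assms by auto
    then show "\<phi> c \<in> nbhd c" using embeddingsD[OF \<phi>(1)] c by (auto simp: nbhd_def)
  qed
  ultimately have "card X \<le> card (\<Pi>\<^sub>E c\<in>verts F - A. nbhd c)"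
    using assms by (intro card_inj_on_le) (auto intro!: finite_PiE simp: nbhd_def)
  then show ?thesis using assms(1) by (simp add: card_PiE X_def nbhd_def color_degree_def)
qed

lemma card_embeddings_at_vertex_le:
  assumes "finite (verts F)" "finite (verts G)" "A \<subseteq> verts F"
  shows "card {\<phi> \<in> embeddings F G. v \<in> \<phi> ` A}
    \<le> (\<Sum>a\<in>A. \<Prod>c\<in>verts F - {a}. color_degree G v (color F {a, c}))"
proof -
  have "{\<phi> \<in> embeddings F G. v \<in> \<phi> ` A} = (\<Union>a\<in>A. {\<phi> \<in> embeddings F G. \<phi> a = v})" by auto
  then have "card {\<phi> \<in> embeddings F G. v \<in> \<phi> ` A} \<le> (\<Sum>a\<in>A. card {\<phi> \<in> embeddings F G. \<phi> a = v})"
    using assms finite_subset by (auto intro!: card_UN_le)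
  also have "\<dots> \<le> (\<Sum>a\<in>A. \<Prod>c\<in>verts F - {a}. color_degree G v (color F {a, c}))"
  proof (rule sum_mono)
    fix a assume "a \<in> A"
    then show "card {\<phi> \<in> embeddings F G. \<phi> a = v}
        \<le> (\<Prod>c\<in>verts F - {a}. color_degree G v (color F {a, c}))"
      using card_embeddings_extending_le[OF assms(1,2), of "{a}" a "\<lambda>_. v"] assms(3) by auto
  qed
  finally show ?thesis .
qed

section \<open>Dominant roles\<close>

locale rainbow_clique =
  fixes R :: "('a, 't) cgraph"
  assumes finite_verts: "finite (verts R)" and rainbow: "rainbow R"
begin

abbreviation K :: "'a set" where "K \<equiv> verts R"

abbreviation k :: nat where "k \<equiv> card K"

abbreviation deg :: "('v, 't) cgraph \<Rightarrow> 'v \<Rightarrow> 'a set \<Rightarrow> real" where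
  "deg G v e \<equiv> real (color_degree G v (color R e))"

lemma color_eq_iff:
  assumes "a \<in> K" "b \<in> K" "a \<noteq> b" "c \<in> K" "d \<in> K" "c \<noteq> d"
  shows "color R {a, b} = color R {c, d} \<longleftrightarrow> {a, b} = {c, d}"
  using rainbow assms by (intro inj_on_eq_iff[of _ "edges R"]) (auto simp: rainbow_def)

lemma sum_deg_le:
  assumes "finite (verts G)" "v \<in> verts G" "E \<subseteq> edges R"
  shows "(\<Sum>e\<in>E. deg G v e) \<le> real (num_verts G - 1)"
proof -
  have inj: "inj_on (color R) E" using rainbow assms(3) by (auto simp: rainbow_def inj_on_subset)
  have "finite E" using assms(3) finite_verts finite_edges finite_subset by blast
  have "(\<Sum>e\<in>E. color_degree G v (color R e)) = (\<Sum>c\<in>color R ` E. color_degree G v c)"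
    by (simp add: sum.reindex[OF inj])
  also have "\<dots> \<le> num_verts G - 1"
    using assms \<open>finite E\<close> by (intro sum_color_degree_le) auto
  finally show ?thesis by (simp flip: of_nat_sum)
qed

definition dominant_role :: "('v, 't) cgraph \<Rightarrow> 'v \<Rightarrow> 'a \<Rightarrow> bool" where
  "dominant_role G v i \<longleftrightarrow>
     i \<in> K \<and> (\<Sum>e\<in>{e \<in> edges R. i \<notin> e}. deg G v e) \<le> 2 * real (num_verts G - 1) / real k"

lemma prod_deg_le_if_dominant_role:
  assumes dom: "dominant_role G v i" and a: "a \<in> K" "a \<noteq> i" and D_subset: "D \<subseteq> K - {a, i}"
  shows "(\<Prod>c\<in>D. deg G v {a, c})
    \<le> real (num_verts G - 1) ^ card D * (2 / (real k * real (card D))) ^ card D"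
proof -
  have finite_D: "finite D" using D_subset finite_verts by (meson finite_Diff finite_subset)
  have inj: "inj_on (\<lambda>c. {a, c}) D" by (auto simp: inj_on_def doubleton_eq_iff)
  have "(\<Sum>c\<in>D. deg G v {a, c}) = (\<Sum>e\<in>(\<lambda>c. {a, c}) ` D. deg G v e)"
    by (simp add: sum.reindex[OF inj])
  also have "\<dots> \<le> (\<Sum>e\<in>{e \<in> edges R. i \<notin> e}. deg G v e)"
    using a D_subset finite_verts by (intro sum_mono2) (auto simp: finite_edges)
  also have "\<dots> \<le> 2 * real (num_verts G - 1) / real k" using dom by (simp add: dominant_role_def)
  finally have sum_le: "(\<Sum>c\<in>D. deg G v {a, c}) \<le> 2 * real (num_verts G - 1) / real k" .
  have "(\<Prod>c\<in>D. deg G v {a, c}) \<le> ((\<Sum>c\<in>D. deg G v {a, c}) / real (card D)) ^ card D"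
    using finite_D by (intro prod_le_mean_power) auto
  also have "\<dots> \<le> (2 * real (num_verts G - 1) / real k / real (card D)) ^ card D"
    using sum_le
    by (intro power_mono divide_right_mono) (auto intro!: sum_nonneg divide_nonneg_nonneg)
  finally show ?thesis by (simp add: mult.commute flip: power_mult_distrib)
qed

end

locale large_rainbow_clique = rainbow_clique R
  for R :: "('a, 't) cgraph" +
  assumes large: "11 \<le> card (verts R)"
begin

lemma ex_dominant_role:
  assumes "finite (verts G)" "v \<in> verts G"
    and many: "(real (num_verts G - 1) / real k) ^ (k - 1)
        \<le> real (card {\<phi> \<in> embeddings R G. v \<in> \<phi> ` K})"
  shows "\<exists>i. dominant_role G v i"
proof -
  define N where "N = real (num_verts G - 1)"
  have total: "(\<Sum>e\<in>nsets K 2. deg G v e) \<le> N"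
    using sum_deg_le[OF assms(1,2), of "edges R"] by (simp add: N_def edges_def)
  have "card {\<phi> \<in> embeddings R G. v \<in> \<phi> ` K}
      \<le> (\<Sum>a\<in>K. \<Prod>b\<in>K - {a}. color_degree G v (color R {a, b}))"
    using finite_verts assms(1,2) by (intro card_embeddings_at_vertex_le) auto
  then have "real (card {\<phi> \<in> embeddings R G. v \<in> \<phi> ` K}) \<le> (\<Sum>a\<in>K. \<Prod>b\<in>K - {a}. deg G v {a, b})"
    by (simp flip: of_nat_sum of_nat_prod)
  with many have "(N / real k) ^ (k - 1) \<le> (\<Sum>a\<in>K. \<Prod>b\<in>K - {a}. deg G v {a, b})"
    unfolding N_def by linarith
  then obtain i where i: "i \<in> K" "N * (1 - 2 / real k) \<le> weighted_degree K (deg G v) i"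
    using ex_large_weighted_degree[of K "deg G v" N] finite_verts large total by auto
  have "(\<Sum>e\<in>{e \<in> nsets K 2. i \<notin> e}. deg G v e) \<le> N - weighted_degree K (deg G v) i"
    using total sum_nsets_eq_weighted_degree_plus[OF finite_verts i(1), of "deg G v"] by linarith
  also have "\<dots> \<le> 2 * N / real k" using i(2) by (simp add: algebra_simps)
  finally show ?thesis using i(1) by (auto simp: dominant_role_def edges_def N_def)
qed

lemma prod_deg_le_if_wrong_role:
  assumes dom: "dominant_role G v i" and a: "a \<in> K" "a \<noteq> i"
  shows "(\<Prod>c\<in>K - {a}. deg G v {a, c})
    \<le> deg G v {i, a} * (real (num_verts G - 1) ^ (k - 2) * (2 / (real k * (real k - 2))) ^ (k - 2))"
proof -
  have i_in: "i \<in> K" using dom by (simp add: dominant_role_def)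
  have others: "K - {a} - {i} = K - {a, i}" "card (K - {a, i}) = k - 2"
    using a i_in finite_verts by (auto simp: card_Diff_subset)
  have "(\<Prod>c\<in>K - {a}. deg G v {a, c}) = deg G v {a, i} * (\<Prod>c\<in>K - {a, i}. deg G v {a, c})"
    using a i_in finite_verts others(1) by (subst prod.remove[of _ i]) auto
  also have "(\<Prod>c\<in>K - {a, i}. deg G v {a, c})
      \<le> real (num_verts G - 1) ^ (k - 2) * (2 / (real k * (real k - 2))) ^ (k - 2)"
    using prod_deg_le_if_dominant_role[OF dom a, of "K - {a, i}"] large
    by (simp add: others(2) of_nat_diff)
  finally show ?thesis by (simp add: mult_left_mono insert_commute)
qed

lemma card_embeddings_wrong_role_le:
  assumes "finite (verts G)" "v \<in> verts G" and dom: "dominant_role G v i"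
  shows "real (card {\<phi> \<in> embeddings R G. v \<in> \<phi> ` (K - {i})})
    \<le> real (num_verts G - 1) ^ (k - 1) / (4 * real k ^ k)"
proof -
  define N where "N = real (num_verts G - 1)"
  define B where "B = N ^ (k - 2) * (2 / (real k * (real k - 2))) ^ (k - 2)"
  have i_in: "i \<in> K" using dom by (simp add: dominant_role_def)
  have B_nonneg: "0 \<le> B" using large by (simp add: B_def N_def)
  have "card {\<phi> \<in> embeddings R G. v \<in> \<phi> ` (K - {i})}
      \<le> (\<Sum>a\<in>K - {i}. \<Prod>c\<in>K - {a}. color_degree G v (color R {a, c}))"
    using finite_verts assms(1,2) by (intro card_embeddings_at_vertex_le) auto
  then have "real (card {\<phi> \<in> embeddings R G. v \<in> \<phi> ` (K - {i})})
      \<le> (\<Sum>a\<in>K - {i}. \<Prod>c\<in>K - {a}. deg G v {a, c})"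
    by (simp flip: of_nat_sum of_nat_prod)
  also have "\<dots> \<le> (\<Sum>a\<in>K - {i}. deg G v {i, a} * B)"
    unfolding B_def N_def by (intro sum_mono prod_deg_le_if_wrong_role[OF dom]) auto
  also have "\<dots> = (\<Sum>e\<in>{e \<in> edges R. i \<in> e}. deg G v e) * B"
    using weighted_degree_eq_sum_nsets[OF i_in, of "deg G v"]
    by (simp add: weighted_degree_def edges_def flip: sum_distrib_right)
  also have "\<dots> \<le> N * B"
    unfolding N_def using B_nonneg by (intro mult_right_mono sum_deg_le assms(1,2)) auto
  also have "\<dots> = N ^ (k - 1) * (2 / (real k * (real k - 2))) ^ (k - 2)"
    using large by (simp add: B_def Suc_diff_Suc numeral_2_eq_2 flip: power_Suc mult.assoc)
  also have "\<dots> \<le> N ^ (k - 1) * (1 / (4 * real k ^ k))"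
    using wrong_role_factor_le[OF large] by (intro mult_left_mono) (auto simp: N_def)
  finally show ?thesis by (simp add: N_def)
qed

lemma card_embeddings_wrong_pair_le:
  assumes "finite (verts G)" "v \<in> verts G" and dom: "dominant_role G v i"
    and ab: "a \<in> K" "b \<in> K" "a \<noteq> b" "a \<noteq> i"
  shows "real k * (real k - 1) * real (card {\<phi> \<in> embeddings R G. \<phi> a = v \<and> \<phi> b = w})
    \<le> 3 * real (num_verts G - 1) ^ (k - 2) / real k ^ k"
proof -
  define N where "N = real (num_verts G - 1)"
  have i_in: "i \<in> K" using dom by (simp add: dominant_role_def)
  have card_others: "card (K - {a, b}) = k - 2"
    using ab finite_verts by (simp add: card_Diff_subset)
  then have "K - {a, b} \<noteq> {}" using large by fastforce
  then obtain z where z: "z \<in> K - {a, b}" "i = b \<or> z = i"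
    using i_in ab by (cases "i = b") auto
  define D where "D = K - {a, b} - {z}"
  have card_D: "card D = k - 3" "D \<subseteq> K - {a, i}" using z card_others by (auto simp: D_def)
  have "card {\<phi> \<in> embeddings R G. \<phi> a = v \<and> \<phi> b = w}
      \<le> (\<Prod>c\<in>K - {a, b}. color_degree G v (color R {a, c}))"
    using card_embeddings_extending_le[OF finite_verts assms(1), of "{a, b}" a "(\<lambda>_. w)(a := v)"] ab
    by simp
  then have "real (card {\<phi> \<in> embeddings R G. \<phi> a = v \<and> \<phi> b = w}) \<le> (\<Prod>c\<in>K - {a, b}. deg G v {a, c})"
    by (simp flip: of_nat_prod)
  also have "\<dots> = deg G v {a, z} * (\<Prod>c\<in>D. deg G v {a, c})"
    unfolding D_def using z finite_verts by (intro prod.remove) auto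
  also have "\<dots> \<le> N * (N ^ (k - 3) * (2 / (real k * (real k - 3))) ^ (k - 3))"
  proof (rule mult_mono)
    show "deg G v {a, z} \<le> N"
      using sum_deg_le[OF assms(1,2), of "{{a, z}}"] ab z by (auto simp: N_def)
    show "(\<Prod>c\<in>D. deg G v {a, c}) \<le> N ^ (k - 3) * (2 / (real k * (real k - 3))) ^ (k - 3)"
      using prod_deg_le_if_dominant_role[OF dom ab(1,4) card_D(2)] card_D(1) large
      by (simp add: N_def of_nat_diff)
  qed (auto simp: N_def prod_nonneg)
  also have "\<dots> = N ^ (k - 2) * (2 / (real k * (real k - 3))) ^ (k - 3)"
    using large by (simp add: power_eq_if[of N "k - 2"])
  finally have "real k * (real k - 1) * real (card {\<phi> \<in> embeddings R G. \<phi> a = v \<and> \<phi> b = w})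
      \<le> N ^ (k - 2) * (real k * (real k - 1) * (2 / (real k * (real k - 3))) ^ (k - 3))"
    using large by (simp add: mult_left_mono mult.left_commute)
  also have "\<dots> \<le> N ^ (k - 2) * (3 / real k ^ k)"
    using wrong_pair_factor_le[OF large] by (intro mult_left_mono) (auto simp: N_def)
  finally show ?thesis by (simp add: N_def mult.commute)
qed

end

section \<open>The upper bound\<close>

context rainbow_clique
begin

definition miscolored :: "('v, 't) cgraph \<Rightarrow> ('v \<Rightarrow> 'a) \<Rightarrow> 'v set set" where
  "miscolored G \<rho> = {e \<in> edges G. inj_on \<rho> e \<and> color G e \<noteq> color R (\<rho> ` e)}"

lemma embedding_without_miscolored_edge:
  assumes "3 \<le> k" and maps: "\<rho> ` verts G \<subseteq> K" and \<phi>: "\<phi> \<in> embeddings R G"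
    and avoids: "\<not> (\<exists>e\<in>miscolored G \<rho>. e \<subseteq> \<phi> ` K)"
  shows "\<phi> \<in> Pi\<^sub>E K (fiber \<rho> (verts G)) \<or>
    (\<exists>i\<in>K. \<phi> \<in> embeddings R (induced G (fiber \<rho> (verts G) i)))"
proof -
  have "{\<rho> (\<phi> a), \<rho> (\<phi> b)} = {a, b}" if ab: "a \<in> K" "b \<in> K" "\<rho> (\<phi> a) \<noteq> \<rho> (\<phi> b)" for a b
  proof -
    have distinct: "a \<noteq> b" "\<phi> a \<noteq> \<phi> b" using ab by auto
    have in_G: "\<phi> a \<in> verts G" "\<phi> b \<in> verts G" using embeddingsD(1)[OF \<phi>] ab by auto
    have "{\<phi> a, \<phi> b} \<notin> miscolored G \<rho>" using avoids ab by auto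
    then have "color R {a, b} = color R {\<rho> (\<phi> a), \<rho> (\<phi> b)}"
      using embeddingsD(3)[OF \<phi> ab(1,2) distinct(1)] in_G distinct ab by (simp add: miscolored_def)
    moreover have "\<rho> (\<phi> a) \<in> K" "\<rho> (\<phi> b) \<in> K" using maps in_G by auto
    ultimately show ?thesis using color_eq_iff[OF ab(1,2) distinct(1)] ab(3) by metis
  qed
  moreover have "\<rho> (\<phi> a) \<in> K" if "a \<in> K" for a using maps embeddingsD(1)[OF \<phi> that] by auto
  ultimately consider i where "i \<in> K" "\<forall>a\<in>K. \<rho> (\<phi> a) = i" | "\<forall>a\<in>K. \<rho> (\<phi> a) = a"
    using constant_or_identity[OF \<open>3 \<le> k\<close>, of "\<lambda>a. \<rho> (\<phi> a)"] by auto
  then show ?thesis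
  proof cases
    case 1
    then have "\<phi> ` K \<subseteq> fiber \<rho> (verts G) i" using embeddingsD(1)[OF \<phi>] by (auto simp: fiber_def)
    with 1 \<phi> show ?thesis by (auto simp: embeddings_induced[OF fiber_subset])
  next
    case 2
    then show ?thesis using \<phi> by (auto simp: embeddings_def fiber_def)
  qed
qed

lemma embeddings_through_pair_subset:
  assumes ab: "a \<in> K" "b \<in> K" "a \<noteq> b" and vw: "v \<noteq> w" "color R {a, b} = color G {v, w}"
  shows "{\<phi> \<in> embeddings R G. {v, w} \<subseteq> \<phi> ` K}
    \<subseteq> {\<phi> \<in> embeddings R G. \<phi> a = v \<and> \<phi> b = w} \<union> {\<phi> \<in> embeddings R G. \<phi> b = v \<and> \<phi> a = w}"
proof
  fix \<phi> assume "\<phi> \<in> {\<phi> \<in> embeddings R G. {v, w} \<subseteq> \<phi> ` K}"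
  then obtain c d where \<phi>: "\<phi> \<in> embeddings R G" and cd: "c \<in> K" "d \<in> K" "\<phi> c = v" "\<phi> d = w" by auto
  then have "c \<noteq> d" using vw by auto
  then have "color R {c, d} = color R {a, b}" using embeddingsD(3)[OF \<phi> cd(1,2)] cd vw by simp
  then have "{c, d} = {a, b}" using color_eq_iff[OF cd(1,2) \<open>c \<noteq> d\<close> ab] by simp
  then show "\<phi> \<in> {\<phi> \<in> embeddings R G. \<phi> a = v \<and> \<phi> b = w} \<union> {\<phi> \<in> embeddings R G. \<phi> b = v \<and> \<phi> a = w}"
    using \<phi> cd by (auto simp: doubleton_eq_iff)
qed

lemma card_embeddings_through_vertex_ge:
  assumes "finite (verts G)" "v \<in> verts G" "2 \<le> k"
    and many: "fractal_bound k (num_verts G) \<le> card (embeddings R G)"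
    and IH: "card (embeddings R (induced G (verts G - {v}))) \<le> fractal_bound k (num_verts G - 1)"
  shows "(real (num_verts G - 1) / real k) ^ (k - 1) \<le> card {\<phi> \<in> embeddings R G. v \<in> \<phi> ` K}"
proof -
  define N where "N = real (num_verts G - 1)"
  have "num_verts G > 0" using assms(1,2) by (auto simp: num_verts_def card_gt_0_iff)
  then have Suc_N: "real (num_verts G) = N + 1" by (simp add: N_def of_nat_diff)
  have "embeddings R G = embeddings R (induced G (verts G - {v})) \<union> {\<phi> \<in> embeddings R G. v \<in> \<phi> ` K}"
    using embeddingsD(1) by (fastforce simp: embeddings_induced)
  then have "card (embeddings R G)
      \<le> card (embeddings R (induced G (verts G - {v}))) + card {\<phi> \<in> embeddings R G. v \<in> \<phi> ` K}"
    by (metis card_Un_le)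
  moreover have "fractal_bound k N + (N / real k) ^ (k - 1) \<le> fractal_bound k (N + 1)"
    using assms(3) by (intro fractal_bound_plus_one_ge) (auto simp: N_def)
  ultimately show ?thesis using many IH unfolding Suc_N N_def[symmetric] by linarith
qed

end

lemma (in large_rainbow_clique) ex_dominant_role_if_many_embeddings:
  assumes "finite (verts G)" "v \<in> verts G"
    and "fractal_bound k (num_verts G) \<le> card (embeddings R G)"
    and IH: "\<And>U. U \<subset> verts G \<Longrightarrow> card (embeddings R (induced G U)) \<le> fractal_bound k (card U)"
  shows "\<exists>i. dominant_role G v i"
proof (rule ex_dominant_role[OF assms(1,2)], rule card_embeddings_through_vertex_ge[OF assms(1,2)])
  have "verts G - {v} \<subset> verts G" "card (verts G - {v}) = num_verts G - 1"
    using assms(1,2) by (auto simp: num_verts_def)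
  then show "card (embeddings R (induced G (verts G - {v}))) \<le> fractal_bound k (num_verts G - 1)"
    using IH by metis
qed (use assms(3) large in simp_all)

locale dominant_partition = large_rainbow_clique R
  for R :: "('a, 't) cgraph" +
  fixes G :: "('v, 't) cgraph" and \<rho> :: "'v \<Rightarrow> 'a"
  assumes finite_verts_G: "finite (verts G)"
    and dominant: "v \<in> verts G \<Longrightarrow> dominant_role G v (\<rho> v)"
    and many_embeddings: "(real (num_verts G) / real (card (verts R))) ^ card (verts R)
        \<le> real (card (embeddings R G))"
begin

abbreviation part :: "'a \<Rightarrow> 'v set" where "part \<equiv> fiber \<rho> (verts G)"

abbreviation n :: nat where "n \<equiv> num_verts G"

lemma role_in_K: "\<rho> ` verts G \<subseteq> K"
  using dominant by (auto simp: dominant_role_def)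

lemma sum_card_part: "(\<Sum>i\<in>K. card (part i)) = n"
  using sum_card_fiber[OF finite_verts_G finite_verts role_in_K] by (simp add: num_verts_def)

lemma card_embeddings_le_transversals_plus_wrong_roles:
  "card (embeddings R G)
    \<le> (\<Prod>i\<in>K. card (part i)) + (\<Sum>v\<in>verts G. card {\<phi> \<in> embeddings R G. v \<in> \<phi> ` (K - {\<rho> v})})"
proof -
  define wrong where "wrong v = {\<phi> \<in> embeddings R G. v \<in> \<phi> ` (K - {\<rho> v})}" for v
  have "embeddings R G \<subseteq> Pi\<^sub>E K part \<union> (\<Union>v\<in>verts G. wrong v)"
  proof
    fix \<phi> assume \<phi>: "\<phi> \<in> embeddings R G"
    show "\<phi> \<in> Pi\<^sub>E K part \<union> (\<Union>v\<in>verts G. wrong v)"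
    proof (cases "\<forall>a\<in>K. \<rho> (\<phi> a) = a")
      case True
      then show ?thesis using \<phi> by (auto simp: embeddings_def fiber_def)
    next
      case False
      then obtain a where "a \<in> K" "\<rho> (\<phi> a) \<noteq> a" by blast
      then have "\<phi> \<in> wrong (\<phi> a)" "\<phi> a \<in> verts G"
        using \<phi> embeddingsD(1)[OF \<phi>] by (auto simp: wrong_def)
      then show ?thesis by blast
    qed
  qed
  then have "card (embeddings R G) \<le> card (Pi\<^sub>E K part \<union> (\<Union>v\<in>verts G. wrong v))"
    using finite_verts finite_verts_G finite_embeddings[OF finite_verts finite_verts_G]
    by (intro card_mono) (auto simp: wrong_def intro!: finite_PiE)
  also have "\<dots> \<le> card (Pi\<^sub>E K part) + card (\<Union>v\<in>verts G. wrong v)" by (rule card_Un_le)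
  also have "card (\<Union>v\<in>verts G. wrong v) \<le> (\<Sum>v\<in>verts G. card (wrong v))"
    by (rule card_UN_le[OF finite_verts_G])
  finally show ?thesis using finite_verts by (simp add: card_PiE wrong_def)
qed

lemma prod_card_part_ge: "3 / 4 * (real n / real k) ^ k \<le> (\<Prod>i\<in>K. real (card (part i)))"
proof -
  define wrong where "wrong v = {\<phi> \<in> embeddings R G. v \<in> \<phi> ` (K - {\<rho> v})}" for v
  have "real (card (wrong v)) \<le> real n ^ (k - 1) / (4 * real k ^ k)" if v: "v \<in> verts G" for v
  proof -
    have "real (card (wrong v)) \<le> real (n - 1) ^ (k - 1) / (4 * real k ^ k)"
      unfolding wrong_def
      by (rule card_embeddings_wrong_role_le[OF finite_verts_G v dominant[OF v]])
    also have "\<dots> \<le> real n ^ (k - 1) / (4 * real k ^ k)" by (intro divide_right_mono power_mono) auto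
    finally show ?thesis .
  qed
  then have "(\<Sum>v\<in>verts G. real (card (wrong v)))
      \<le> (\<Sum>v\<in>verts G. real n ^ (k - 1) / (4 * real k ^ k))"
    by (rule sum_mono)
  also have "\<dots> = (real n / real k) ^ k / 4"
    using large by (simp add: num_verts_def power_divide power_eq_if[of "real (card (verts G))" k])
  finally have "(\<Sum>v\<in>verts G. real (card (wrong v))) \<le> (real n / real k) ^ k / 4" .
  moreover have "real (card (embeddings R G))
      \<le> real ((\<Prod>i\<in>K. card (part i)) + (\<Sum>v\<in>verts G. card (wrong v)))"
    unfolding of_nat_le_iff wrong_def by (rule card_embeddings_le_transversals_plus_wrong_roles)
  ultimately show ?thesis using many_embeddings by simp
qed

lemma part_nonempty:
  assumes "verts G \<noteq> {}" "i \<in> K"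
  shows "part i \<noteq> {}"
proof -
  have "n > 0" using assms finite_verts_G by (simp add: num_verts_def card_gt_0_iff)
  moreover have "k > 0" using large by simp
  ultimately have "0 < 3 / 4 * (real n / real k) ^ k" by (intro mult_pos_pos zero_less_power) auto
  then have "(\<Prod>i\<in>K. real (card (part i))) \<noteq> 0" using prod_card_part_ge by linarith
  then show ?thesis using assms(2) finite_verts by (auto simp: prod_zero_iff)
qed

lemma part_psubset:
  assumes "verts G \<noteq> {}" "i \<in> K"
  shows "part i \<subset> verts G"
proof -
  have "\<not> K \<subseteq> {i}" using large card_mono[of "{i}" K] by auto
  then obtain j where "j \<in> K" "j \<noteq> i" by blast
  with part_nonempty[OF assms(1), of j] show ?thesis by (auto simp: fiber_def)
qed

lemma prod_card_other_parts_ge: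
  assumes "verts G \<noteq> {}" and ij: "i \<in> K" "j \<in> K" "i \<noteq> j"
  shows "3 * real n ^ (k - 2) / real k ^ k \<le> (\<Prod>l\<in>K - {i, j}. real (card (part l)))"
proof -
  define p where "p l = real (card (part l))" for l
  define Q where "Q = (\<Prod>l\<in>K - {i, j}. p l)"
  have n_pos: "real n > 0" using assms(1) finite_verts_G by (simp add: num_verts_def card_gt_0_iff)
  have p_nonneg: "0 \<le> p l" for l by (simp add: p_def)
  have Q_nonneg: "0 \<le> Q" using p_nonneg by (simp add: Q_def prod_nonneg)
  have "(\<Sum>l\<in>{i, j}. p l) \<le> (\<Sum>l\<in>K. p l)" using ij finite_verts p_nonneg by (intro sum_mono2) auto
  also have "\<dots> = real n" using sum_card_part by (simp add: p_def flip: of_nat_sum)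
  finally have "(p i + p j)\<^sup>2 \<le> (real n)\<^sup>2" using ij p_nonneg by (intro power_mono) auto
  then have prod_ij_le: "p i * p j \<le> (real n)\<^sup>2 / 4"
    using zero_le_power2[of "p i - p j"] by (simp add: power2_eq_square algebra_simps)
  have "3 / 4 * (real n ^ k / real k ^ k) \<le> (\<Prod>l\<in>K. p l)"
    using prod_card_part_ge by (simp add: p_def power_divide)
  also have "\<dots> = Q * (\<Prod>l\<in>{i, j}. p l)"
    unfolding Q_def using ij finite_verts by (intro prod.subset_diff) auto
  also have "\<dots> \<le> Q * ((real n)\<^sup>2 / 4)" using prod_ij_le Q_nonneg ij by (intro mult_left_mono) auto
  also have "real n ^ k = (real n)\<^sup>2 * real n ^ (k - 2)"
  proof -
    have "k = 2 + (k - 2)" using large by simp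
    then show ?thesis by (metis power_add)
  qed
  finally have "(real n)\<^sup>2 * (3 * real n ^ (k - 2) / real k ^ k) \<le> (real n)\<^sup>2 * Q"
    by (simp add: mult_ac)
  then have "3 * real n ^ (k - 2) / real k ^ k \<le> Q"
    by (rule mult_left_le_imp_le) (use n_pos in simp)
  then show ?thesis by (simp add: Q_def p_def)
qed

lemma card_miscolored_le:
  "card {e \<in> miscolored G \<rho>. e \<subseteq> \<psi> ` K} \<le> k choose 2"
proof -
  have "{e \<in> miscolored G \<rho>. e \<subseteq> \<psi> ` K} \<subseteq> nsets (\<psi> ` K) 2"
    by (auto simp: miscolored_def edges_def nsets_def)
  then have "card {e \<in> miscolored G \<rho>. e \<subseteq> \<psi> ` K} \<le> card (nsets (\<psi> ` K) 2)"
    using finite_verts by (intro card_mono) (auto simp: finite_imp_finite_nsets)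
  also have "\<dots> \<le> k choose 2"
    using card_image_le[OF finite_verts, of \<psi>] by (simp add: binomial_right_mono)
  finally show ?thesis .
qed

lemma card_embeddings_onto_miscolored_pair_le:
  assumes miscolored: "{v, w} \<in> miscolored G \<rho>"
    and ab: "a \<in> K" "b \<in> K" "a \<noteq> b" "color R {a, b} = color G {v, w}"
  shows "real k * (real k - 1) * real (card {\<phi> \<in> embeddings R G. \<phi> a = v \<and> \<phi> b = w})
    \<le> 3 * real (n - 1) ^ (k - 2) / real k ^ k"
proof (cases "a = \<rho> v")
  case False
  have "v \<in> verts G" using miscolored by (simp add: miscolored_def)
  then show ?thesis
    using card_embeddings_wrong_pair_le[OF finite_verts_G _ dominant ab(1-3) False] by simp
next
  case True
  then have "b \<noteq> \<rho> w" "w \<in> verts G" using miscolored ab(4) by (auto simp: miscolored_def)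
  moreover have "{\<phi> \<in> embeddings R G. \<phi> a = v \<and> \<phi> b = w} = {\<phi> \<in> embeddings R G. \<phi> b = w \<and> \<phi> a = v}"
    by auto
  ultimately show ?thesis
    using card_embeddings_wrong_pair_le[OF finite_verts_G _ dominant ab(2,1)] ab(3) by simp
qed

lemma card_embeddings_through_miscolored_le:
  assumes e_in: "e \<in> miscolored G \<rho>"
  shows "real (k choose 2) * real (card {\<phi> \<in> embeddings R G. e \<subseteq> \<phi> ` K})
      \<le> 3 * real n ^ (k - 2) / real k ^ k"
proof (cases "{\<phi> \<in> embeddings R G. e \<subseteq> \<phi> ` K} = {}")
  case True
  show ?thesis unfolding True by simp
next
  case False
  obtain v w where vw: "e = {v, w}" "v \<noteq> w"
    using e_in by (auto simp: miscolored_def edges_def nsets_2_eq)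
  define onto where "onto a b = {\<phi> \<in> embeddings R G. \<phi> a = v \<and> \<phi> b = w}" for a b
  define c where "c = real k * (real k - 1)"
  obtain \<phi> a b where "\<phi> \<in> embeddings R G" and ab: "a \<in> K" "b \<in> K" "\<phi> a = v" "\<phi> b = w"
    using False vw(1) by auto
  then have "a \<noteq> b" and color: "color R {a, b} = color G {v, w}"
    using embeddingsD(3) vw(2) by fastforce+
  have "card {\<phi> \<in> embeddings R G. e \<subseteq> \<phi> ` K} \<le> card (onto a b \<union> onto b a)"
    using embeddings_through_pair_subset[OF ab(1,2) \<open>a \<noteq> b\<close> vw(2) color]
      finite_embeddings[OF finite_verts finite_verts_G]
    by (intro card_mono) (auto simp: onto_def vw(1) conj_commute)
  also have "\<dots> \<le> card (onto a b) + card (onto b a)" by (rule card_Un_le)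
  finally have "real (card {\<phi> \<in> embeddings R G. e \<subseteq> \<phi> ` K})
      \<le> real (card (onto a b)) + real (card (onto b a))"
    by simp
  then have "c * real (card {\<phi> \<in> embeddings R G. e \<subseteq> \<phi> ` K})
      \<le> c * real (card (onto a b)) + c * real (card (onto b a))"
    using large by (simp add: c_def mult_left_mono flip: distrib_left)
  also have "\<dots> \<le> 2 * (3 * real (n - 1) ^ (k - 2) / real k ^ k)"
    using card_embeddings_onto_miscolored_pair_le[OF e_in[unfolded vw(1)] ab(1,2) \<open>a \<noteq> b\<close> color]
      card_embeddings_onto_miscolored_pair_le[OF e_in[unfolded vw(1)] ab(2,1)] \<open>a \<noteq> b\<close> color
    by (simp add: c_def onto_def insert_commute)
  also have "\<dots> \<le> 2 * (3 * real n ^ (k - 2) / real k ^ k)"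
    by (intro mult_left_mono divide_right_mono power_mono) auto
  also have "c = 2 * real (k choose 2)"
    using large by (simp add: c_def choose_two real_of_nat_div of_nat_diff)
  finally show ?thesis by simp
qed

lemma card_embeddings_hitting_miscolored_le:
  "card {\<phi> \<in> embeddings R G. \<exists>e\<in>miscolored G \<rho>. e \<subseteq> \<phi> ` K}
    \<le> card {\<psi> \<in> Pi\<^sub>E K part. \<exists>e\<in>miscolored G \<rho>. e \<subseteq> \<psi> ` K}"
proof (rule card_hitting_le_card_hitting)
  show "finite (miscolored G \<rho>)" using finite_verts_G by (simp add: miscolored_def finite_edges)
  show "finite (Pi\<^sub>E K part)" using finite_verts finite_verts_G by (simp add: finite_PiE)
  show "0 < k choose 2" using large by simp
  show "card {e \<in> miscolored G \<rho>. e \<subseteq> \<psi> ` K} \<le> k choose 2" for \<psi> by (rule card_miscolored_le)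
  fix e assume e_in: "e \<in> miscolored G \<rho>"
  then obtain v w where vw: "e = {v, w}" "v \<in> verts G" "w \<in> verts G" "\<rho> v \<noteq> \<rho> w"
    by (fastforce simp: miscolored_def edges_def nsets_2_eq)
  then have roles: "\<rho> v \<in> K" "\<rho> w \<in> K" using role_in_K by auto
  have "real ((k choose 2) * card {\<phi> \<in> embeddings R G. e \<subseteq> \<phi> ` K})
      \<le> 3 * real n ^ (k - 2) / real k ^ k"
    using card_embeddings_through_miscolored_le[OF e_in] by simp
  also have "\<dots> \<le> (\<Prod>l\<in>K - {\<rho> v, \<rho> w}. real (card (part l)))"
    using vw roles by (intro prod_card_other_parts_ge) auto
  also have "\<dots> = real (\<Prod>l\<in>K - {\<rho> v, \<rho> w}. card (part l))" by simp
  also have "\<dots> \<le> real (card {\<psi> \<in> Pi\<^sub>E K part. e \<subseteq> \<psi> ` K})"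
    unfolding vw(1) of_nat_le_iff using vw roles finite_verts finite_verts_G
    by (intro prod_card_le_card_PiE_through_pair) (auto simp: fiber_def)
  finally show "(k choose 2) * card {\<phi> \<in> embeddings R G. e \<subseteq> \<phi> ` K}
      \<le> card {\<psi> \<in> Pi\<^sub>E K part. e \<subseteq> \<psi> ` K}"
    unfolding of_nat_le_iff .
qed

lemma card_embeddings_le_prod_plus_sum:
  "card (embeddings R G) \<le> (\<Prod>i\<in>K. card (part i)) + (\<Sum>i\<in>K. card (embeddings R (induced G (part i))))"
proof -
  define hits where "hits \<psi> \<longleftrightarrow> (\<exists>e\<in>miscolored G \<rho>. e \<subseteq> \<psi> ` K)" for \<psi>
  define P where "P = Pi\<^sub>E K part"
  define I where "I = (\<Union>i\<in>K. embeddings R (induced G (part i)))"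
  have finite_sets: "finite P" "finite I" "finite (embeddings R G)"
    using finite_verts finite_verts_G by (auto simp: P_def I_def finite_PiE finite_embeddings)
  have "embeddings R G \<subseteq> {\<phi> \<in> embeddings R G. hits \<phi>} \<union> ({\<psi> \<in> P. \<not> hits \<psi>} \<union> I)"
    using embedding_without_miscolored_edge[OF _ role_in_K] large
    by (auto simp: hits_def P_def I_def)
  then have "card (embeddings R G) \<le> card ({\<phi> \<in> embeddings R G. hits \<phi>} \<union> ({\<psi> \<in> P. \<not> hits \<psi>} \<union> I))"
    using finite_sets by (intro card_mono) auto
  also have "\<dots> \<le> card {\<phi> \<in> embeddings R G. hits \<phi>} + (card {\<psi> \<in> P. \<not> hits \<psi>} + card I)"
    by (intro order_trans[OF card_Un_le] add_left_mono card_Un_le)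
  also have "card {\<phi> \<in> embeddings R G. hits \<phi>} \<le> card {\<psi> \<in> P. hits \<psi>}"
    unfolding hits_def P_def by (rule card_embeddings_hitting_miscolored_le)
  also have "card {\<psi> \<in> P. hits \<psi>} + (card {\<psi> \<in> P. \<not> hits \<psi>} + card I) = card P + card I"
    using card_Un_disjoint[of "{\<psi> \<in> P. hits \<psi>}" "{\<psi> \<in> P. \<not> hits \<psi>}"] finite_sets
    by (simp add: Collect_disj_eq[symmetric] conj_disj_distribL[symmetric] disjoint_iff)
  also have "card P = (\<Prod>i\<in>K. card (part i))" using finite_verts by (simp add: P_def card_PiE)
  also have "card I \<le> (\<Sum>i\<in>K. card (embeddings R (induced G (part i))))"
    unfolding I_def by (rule card_UN_le[OF finite_verts])
  finally show ?thesis by simp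
qed

lemma card_embeddings_le_fractal_bound_if_parts:
  assumes "\<And>i. i \<in> K \<Longrightarrow> card (embeddings R (induced G (part i))) \<le> fractal_bound k (card (part i))"
  shows "card (embeddings R G) \<le> fractal_bound k n"
proof -
  have "real (card (embeddings R G))
      \<le> real ((\<Prod>i\<in>K. card (part i)) + (\<Sum>i\<in>K. card (embeddings R (induced G (part i)))))"
    unfolding of_nat_le_iff by (rule card_embeddings_le_prod_plus_sum)
  also have "\<dots> \<le> (\<Prod>i\<in>K. real (card (part i))) + (\<Sum>i\<in>K. fractal_bound k (card (part i)))"
    using assms by (simp add: sum_mono)
  also have "\<dots> \<le> fractal_bound k (\<Sum>i\<in>K. real (card (part i)))"
    using finite_verts large by (intro prod_plus_sum_fractal_bound_le) auto
  also have "(\<Sum>i\<in>K. real (card (part i))) = real n" unfolding sum_card_part[symmetric] by simp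
  finally show ?thesis .
qed

end

theorem (in large_rainbow_clique) card_embeddings_le:
  fixes G :: "('v, 't) cgraph"
  assumes "finite (verts G)"
  shows "card (embeddings R G) \<le> fractal_bound k (num_verts G)"
  using assms
proof (induction "num_verts G" arbitrary: G rule: less_induct)
  case less
  have IH: "card (embeddings R (induced G U)) \<le> fractal_bound k (card U)" if "U \<subset> verts G" for U
    using less.hyps[of "induced G U"] less.prems that psubset_card_mono[OF less.prems that]
      finite_subset[of U "verts G"] by (auto simp: num_verts_def)
  show ?case
  proof (rule ccontr)
    assume "\<not> ?thesis"
    then have many: "fractal_bound k (num_verts G) < card (embeddings R G)" by simp
    have bound_ge: "(real (num_verts G) / real k) ^ k \<le> fractal_bound k (num_verts G)"
      using large by (intro power_le_fractal_bound) auto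
    moreover have "0 \<le> (real (num_verts G) / real k) ^ k" by simp
    ultimately have "card (embeddings R G) \<noteq> 0" using many by linarith
    then have "embeddings R G \<noteq> {}" by force
    moreover have "K \<noteq> {}" using large by auto
    ultimately have nonempty: "verts G \<noteq> {}" using embeddingsD(1) by fastforce
    have "\<exists>i. dominant_role G v i" if "v \<in> verts G" for v
      using many by (intro ex_dominant_role_if_many_embeddings less.prems that IH) simp
    then obtain \<rho> where "\<And>v. v \<in> verts G \<Longrightarrow> dominant_role G v (\<rho> v)" by metis
    then interpret dominant_partition R G \<rho>
    proof unfold_locales
      show "(real (num_verts G) / real k) ^ k \<le> card (embeddings R G)"
        using bound_ge many by linarith
    qed (use less.prems in auto)
    have "card (embeddings R G) \<le> fractal_bound k (num_verts G)"
      by (intro card_embeddings_le_fractal_bound_if_parts IH part_psubset nonempty)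
    with many show False by simp
  qed
qed

corollary (in large_rainbow_clique) copies_le_fractal_bound:
  assumes "finite (verts G)"
  shows "copies R G \<le> fractal_bound (num_verts R) (num_verts G)"
  using copies_le_card_embeddings[OF finite_verts assms] card_embeddings_le[OF assms]
  by (simp add: num_verts_def)

section \<open>The lower bound\<close>

lemma inj_on_PiE_disjoint:
  assumes "disjoint_family_on V K" "\<psi> \<in> Pi\<^sub>E K V"
  shows "inj_on \<psi> K"
proof (rule inj_onI)
  fix i j assume "i \<in> K" "j \<in> K" "\<psi> i = \<psi> j"
  then have "\<psi> i \<in> V i \<inter> V j" using PiE_mem[OF assms(2)] by fastforce
  then show "i = j" using assms(1) \<open>i \<in> K\<close> \<open>j \<in> K\<close> by (auto simp: disjoint_family_on_def)
qed

lemma inj_on_image_PiE_disjoint: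
  assumes "disjoint_family_on V K"
  shows "inj_on (\<lambda>\<psi>. \<psi> ` K) (Pi\<^sub>E K V)"
proof (rule inj_onI, rule PiE_ext)
  fix \<psi> \<chi> i
  assume \<psi>: "\<psi> \<in> Pi\<^sub>E K V" and \<chi>: "\<chi> \<in> Pi\<^sub>E K V" and "\<psi> ` K = \<chi> ` K" and i: "i \<in> K"
  then obtain j where j_in: "j \<in> K" "\<psi> i = \<chi> j" by blast
  then have "\<psi> i \<in> V i \<inter> V j" using PiE_mem[OF \<psi> i] PiE_mem[OF \<chi> j_in(1)] by simp
  then have "i = j" using assms i j_in(1) by (auto simp: disjoint_family_on_def)
  with j_in show "\<psi> i = \<chi> i" by simp
qed

lemma transversal_in_embeddings:
  assumes union: "verts G = (\<Union>i\<in>verts F. V i)" and disjoint: "disjoint_family_on V (verts F)"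
    and across: "\<And>i j v w. i \<in> verts F \<Longrightarrow> j \<in> verts F \<Longrightarrow> i \<noteq> j \<Longrightarrow> v \<in> V i \<Longrightarrow> w \<in> V j \<Longrightarrow>
      color G {v, w} = color F {i, j}"
    and \<psi>: "\<psi> \<in> Pi\<^sub>E (verts F) V"
  shows "\<psi> \<in> embeddings F G"
proof -
  have "\<psi> \<in> verts F \<rightarrow>\<^sub>E verts G" using \<psi> union by (auto simp: PiE_iff)
  moreover have "color G (\<psi> ` e) = color F e" if e: "e \<in> edges F" for e
  proof -
    obtain i j where ij: "i \<in> verts F" "j \<in> verts F" "i \<noteq> j" "e = {i, j}"
      using e by (auto simp: edges_def nsets_2_eq)
    then show ?thesis using across[OF ij(1-3)] PiE_mem[OF \<psi>] by simp
  qed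
  ultimately show ?thesis using inj_on_PiE_disjoint[OF disjoint \<psi>] by (simp add: embeddings_def)
qed

lemma finite_copy_sets: "finite (verts G) \<Longrightarrow> finite (copy_sets F G)"
  by (simp add: copy_sets_def finite_imp_finite_nsets)

lemma copy_sets_induced:
  assumes "U \<subseteq> verts G"
  shows "copy_sets F (induced G U) = {S \<in> copy_sets F G. S \<subseteq> U}"
  using assms by (auto simp: copy_sets_def nsets_def induced_def)

lemma card_UN_copy_sets_induced:
  assumes pattern: "finite (verts F)" "num_verts F \<ge> 1" and finite_G: "finite (verts G)"
    and union: "verts G = (\<Union>i\<in>verts F. V i)" and disjoint: "disjoint_family_on V (verts F)"
  shows "card (\<Union>i\<in>verts F. copy_sets F (induced G (V i)))
      = (\<Sum>i\<in>verts F. copies F (induced G (V i)))"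
  unfolding copies_eq_card_copy_sets
proof (intro card_UN_disjoint ballI impI)
  have part_subset: "V i \<subseteq> verts G" if "i \<in> verts F" for i using union that by blast
  fix i assume i: "i \<in> verts F"
  show "finite (copy_sets F (induced G (V i)))"
    using finite_subset[OF part_subset[OF i] finite_G] by (simp add: finite_copy_sets)
  fix j assume j: "j \<in> verts F" "i \<noteq> j"
  then have "V i \<inter> V j = {}" using disjoint i by (simp add: disjoint_family_on_def)
  moreover have "S \<noteq> {}" if "S \<in> copy_sets F G" for S
    using that pattern(2) by (auto simp: copy_sets_def nsets_def)
  ultimately show "copy_sets F (induced G (V i)) \<inter> copy_sets F (induced G (V j)) = {}"
    unfolding copy_sets_induced[OF part_subset[OF i]] copy_sets_induced[OF part_subset[OF j(1)]]
    by blast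
qed (rule pattern(1))

lemma prod_plus_sum_copies_le_copies:
  assumes pattern: "finite (verts F)" "num_verts F \<ge> 2" and finite_G: "finite (verts G)"
    and union: "verts G = (\<Union>i\<in>verts F. V i)" and disjoint: "disjoint_family_on V (verts F)"
    and across: "\<And>i j v w. i \<in> verts F \<Longrightarrow> j \<in> verts F \<Longrightarrow> i \<noteq> j \<Longrightarrow> v \<in> V i \<Longrightarrow> w \<in> V j \<Longrightarrow>
      color G {v, w} = color F {i, j}"
  shows "(\<Prod>i\<in>verts F. card (V i)) + (\<Sum>i\<in>verts F. copies F (induced G (V i))) \<le> copies F G"
proof -
  define P where "P = Pi\<^sub>E (verts F) V"
  define I where "I = (\<Union>i\<in>verts F. copy_sets F (induced G (V i)))"
  have part_subset: "V i \<subseteq> verts G" if "i \<in> verts F" for i using union that by blast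
  have transversals_subset: "(\<lambda>\<psi>. \<psi> ` verts F) ` P \<subseteq> copy_sets F G"
    using transversal_in_embeddings[OF union disjoint across]
      image_embedding_in_copy_sets[OF pattern(1)] by (auto simp: P_def)
  have I_subset: "I \<subseteq> copy_sets F G" by (auto simp: I_def copy_sets_induced[OF part_subset])
  have "(\<lambda>\<psi>. \<psi> ` verts F) ` P \<inter> I = {}"
  proof (rule ccontr)
    assume "(\<lambda>\<psi>. \<psi> ` verts F) ` P \<inter> I \<noteq> {}"
    then obtain \<psi> i where \<psi>: "\<psi> \<in> P" "\<psi> ` verts F \<subseteq> V i" and i: "i \<in> verts F"
      by (auto simp: I_def copy_sets_induced[OF part_subset])
    have "\<not> verts F \<subseteq> {i}" using pattern card_mono[of "{i}" "verts F"] by (auto simp: num_verts_def)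
    then obtain j where j: "j \<in> verts F" "j \<noteq> i" by blast
    then have "\<psi> j \<in> V i \<inter> V j" using \<psi> by (auto simp: P_def)
    then show False using disjoint i j by (auto simp: disjoint_family_on_def)
  qed
  moreover have "card ((\<lambda>\<psi>. \<psi> ` verts F) ` P) = (\<Prod>i\<in>verts F. card (V i))"
    using pattern(1)
    by (simp add: P_def card_image[OF inj_on_image_PiE_disjoint[OF disjoint]] card_PiE)
  moreover have "card I = (\<Sum>i\<in>verts F. copies F (induced G (V i)))"
    unfolding I_def using pattern
    by (intro card_UN_copy_sets_induced[OF _ _ finite_G union disjoint]) auto
  moreover have finite_copies_G: "finite (copy_sets F G)" using finite_G by (rule finite_copy_sets)
  ultimately have "(\<Prod>i\<in>verts F. card (V i)) + (\<Sum>i\<in>verts F. copies F (induced G (V i)))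
      = card ((\<lambda>\<psi>. \<psi> ` verts F) ` P \<union> I)"
    using card_Un_disjoint finite_subset[OF transversals_subset finite_copies_G]
      finite_subset[OF I_subset finite_copies_G] by metis
  also have "\<dots> \<le> copies F G"
    unfolding copies_eq_card_copy_sets using transversals_subset I_subset finite_copies_G
    by (intro card_mono) auto
  finally show ?thesis .
qed

lemma mean_minus_one_le:
  fixes p :: "'a \<Rightarrow> real"
  assumes "finite K" "i \<in> K" "\<And>j. j \<in> K \<Longrightarrow> p j \<le> p i + 1"
  shows "(\<Sum>j\<in>K. p j) / card K - 1 \<le> p i"
proof -
  have "card K > 0" using assms card_gt_0_iff by blast
  moreover have "(\<Sum>j\<in>K. p j) \<le> (\<Sum>j\<in>K. p i + 1)" using assms by (intro sum_mono)
  ultimately show ?thesis by (simp add: field_simps)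
qed

lemma le_mean_plus_one:
  fixes p :: "'a \<Rightarrow> real"
  assumes "finite K" "i \<in> K" "\<And>j. j \<in> K \<Longrightarrow> p i \<le> p j + 1"
  shows "p i \<le> (\<Sum>j\<in>K. p j) / card K + 1"
  using mean_minus_one_le[of K i "\<lambda>j. - p j"] assms by (force simp: sum_negf)

lemma fractal_bound_recursion:
  assumes k_ge: "k \<ge> 4" and "x \<ge> 1"
  shows "fractal_bound k (real k * x) - (real k * x) ^ (k - 1)
    \<le> (x - 1) ^ k + real k * (fractal_bound k (x - 1) - (2 * x) ^ (k - 1))"
proof -
  define D where "D = real k ^ k - real k"
  have D_ge: "real k \<le> D" "D > 0"
    using two_mult_le_power_self[of k] k_ge unfolding D_def by linarith+
  define c where "c = 1 + real k / D"
  have c_bounds: "0 \<le> c" "c \<le> 2" "c = real k ^ k / D"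
    using D_ge by (auto simp: c_def D_def field_simps)
  have "x ^ k - real k * x ^ (k - 1) \<le> (x - 1) ^ k"
    using Bernoulli_homogeneous[of x "-1" k] assms by simp
  then have "(x ^ k - real k * x ^ (k - 1)) * c \<le> (x - 1) ^ k * c"
    using c_bounds by (intro mult_right_mono)
  moreover have "real k * x ^ (k - 1) * c \<le> real k * x ^ (k - 1) * 2"
    using c_bounds assms by (intro mult_left_mono) auto
  moreover have "(2 * real k + real k * 2 ^ (k - 1)) * x ^ (k - 1) \<le> real k ^ (k - 1) * x ^ (k - 1)"
    using two_mult_plus_power_two_le[OF k_ge] assms by (intro mult_right_mono) auto
  ultimately have "x ^ k * c - (real k * x) ^ (k - 1)
      \<le> (x - 1) ^ k * c - real k * (2 * x) ^ (k - 1)"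
    by (simp add: algebra_simps power_mult_distrib)
  also have "(x - 1) ^ k * c = (x - 1) ^ k + real k * fractal_bound k (x - 1)"
    by (simp add: c_def fractal_bound_def D_def[symmetric] algebra_simps)
  also have "x ^ k * c = fractal_bound k (real k * x)"
    by (simp add: c_bounds(3) fractal_bound_def D_def[symmetric] power_mult_distrib)
  finally show ?thesis by (simp add: algebra_simps)
qed

lemma fractal_bound_recursion_balanced:
  fixes p :: "'a \<Rightarrow> real"
  assumes card_K: "finite K" "card K = k" "k \<ge> 4"
    and balanced: "\<And>i j. i \<in> K \<Longrightarrow> j \<in> K \<Longrightarrow> p i \<le> p j + 1"
    and total: "n = (\<Sum>i\<in>K. p i)" "real k \<le> n"
  shows "fractal_bound k n - n ^ (k - 1)
      \<le> (\<Prod>i\<in>K. p i) + (\<Sum>i\<in>K. fractal_bound k (p i) - p i ^ (k - 1))"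
proof -
  define x where "x = n / real k"
  have n_eq: "n = real k * x" "x \<ge> 1" using card_K total(2) by (simp_all add: x_def)
  have lower: "x - 1 \<le> p i" if "i \<in> K" for i
    using mean_minus_one_le[OF card_K(1) that, of p] balanced[OF _ that]
    by (simp add: x_def total(1) card_K(2))
  have upper: "p i \<le> 2 * x" if "i \<in> K" for i
    using le_mean_plus_one[OF card_K(1) that, of p] balanced[OF that] n_eq(2)
    by (simp add: x_def total(1) card_K(2))
  have nonneg: "0 \<le> p i" if "i \<in> K" for i using lower[OF that] n_eq(2) by linarith
  have "(x - 1) ^ k = (\<Prod>i\<in>K. x - 1)" using card_K by simp
  also have "\<dots> \<le> (\<Prod>i\<in>K. p i)" using lower n_eq(2) by (intro prod_mono) auto
  finally have prod: "(x - 1) ^ k \<le> (\<Prod>i\<in>K. p i)" .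
  have "real k * (fractal_bound k (x - 1) - (2 * x) ^ (k - 1))
      = (\<Sum>i\<in>K. fractal_bound k (x - 1) - (2 * x) ^ (k - 1))" using card_K by simp
  also have "\<dots> \<le> (\<Sum>i\<in>K. fractal_bound k (p i) - p i ^ (k - 1))"
    using card_K n_eq(2) lower upper nonneg
    by (intro sum_mono diff_mono fractal_bound_mono power_mono) auto
  finally show ?thesis
    using fractal_bound_recursion[OF card_K(3) n_eq(2)] prod unfolding n_eq(1) by linarith
qed

lemma fractal_bound_le_power_pred:
  assumes "k \<ge> 2" "0 \<le> x" "x \<le> real k"
  shows "fractal_bound k x \<le> x ^ (k - 1)"
proof -
  have "x \<le> real k ^ k - real k" using two_mult_le_power_self[OF assms(1)] assms(3) by linarith
  then have "x / (real k ^ k - real k) \<le> 1" using less_power_self[OF assms(1)] by simp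
  then have "x / (real k ^ k - real k) * x ^ (k - 1) \<le> 1 * x ^ (k - 1)"
    using assms(2) by (intro mult_right_mono) auto
  then show ?thesis using assms(1) by (simp add: fractal_bound_def power_eq_if[of x k])
qed

lemma copies_iterated_blowup_ge:
  assumes pattern: "finite (verts F)" "num_verts F \<ge> 4" and "iterated_blowup T F G"
  shows "fractal_bound (num_verts F) (num_verts G) - real (num_verts G) ^ (num_verts F - 1)
      \<le> copies F G"
  using assms(3)
proof (induction rule: iterated_blowup.induct)
  case (small G)
  then have "fractal_bound (num_verts F) (num_verts G) \<le> real (num_verts G) ^ (num_verts F - 1)"
    using pattern(2) by (intro fractal_bound_le_power_pred) auto
  then show ?case by linarith
next
  case (blowup G V)
  let ?k = "num_verts F"
  have finite_G: "finite (verts G)" using blowup.hyps(1) by (simp add: colored_complete_def)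
  have finite_V: "finite (V i)" if "i \<in> verts F" for i
    using finite_G that by (auto simp: blowup.hyps(3) intro: finite_subset)
  have "num_verts G = (\<Sum>i\<in>verts F. card (V i))"
    unfolding num_verts_def blowup.hyps(3)
    using pattern(1) blowup.hyps(4) finite_V
    by (intro card_UN_disjoint) (auto simp: disjoint_family_on_def)
  then have total: "real (num_verts G) = (\<Sum>i\<in>verts F. real (card (V i)))" by simp
  have balanced: "real (card (V i)) \<le> real (card (V j)) + 1" if "i \<in> verts F" "j \<in> verts F" for i j
    using blowup.hyps(5)[rule_format, OF that] by linarith
  have "fractal_bound ?k (num_verts G) - real (num_verts G) ^ (?k - 1)
      \<le> (\<Prod>i\<in>verts F. real (card (V i)))
        + (\<Sum>i\<in>verts F. fractal_bound ?k (card (V i)) - real (card (V i)) ^ (?k - 1))"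
    using blowup.hyps(2)
    by (intro fractal_bound_recursion_balanced[OF pattern(1) _ pattern(2) balanced total])
      (simp_all add: num_verts_def)
  also have "\<dots> \<le> (\<Prod>i\<in>verts F. real (card (V i))) + (\<Sum>i\<in>verts F. real (copies F (induced G (V i))))"
    using blowup.IH by (intro add_left_mono sum_mono) (simp add: num_verts_def)
  also have "\<dots> = real ((\<Prod>i\<in>verts F. card (V i)) + (\<Sum>i\<in>verts F. copies F (induced G (V i))))" by simp
  also have "\<dots> \<le> real (copies F G)"
    unfolding of_nat_le_iff using pattern(2) blowup.hyps(6)
    by (intro prod_plus_sum_copies_le_copies[OF pattern(1) _ finite_G blowup.hyps(3,4)]) auto
  finally show ?case .
qed

section \<open>Existence of iterated blow-ups\<close>

definition residue_class :: "nat \<Rightarrow> nat \<Rightarrow> nat \<Rightarrow> nat set" where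
  "residue_class n q s = {v. v < n \<and> v mod q = s}"

lemma finite_residue_class [simp]: "finite (residue_class n q s)"
  by (simp add: residue_class_def)

lemma card_residue_class:
  assumes "s < q"
  shows "card (residue_class n q s) = n div q + (if s < n mod q then 1 else 0)"
proof (induction n)
  case (Suc n)
  have "residue_class (Suc n) q s = residue_class n q s \<union> (if n mod q = s then {n} else {})"
    by (auto simp: residue_class_def less_Suc_eq)
  then have "card (residue_class (Suc n) q s)
      = card (residue_class n q s) + (if n mod q = s then 1 else 0)"
    by (simp add: residue_class_def)
  then show ?case using Suc assms by (auto simp: div_Suc mod_Suc)
qed (simp add: residue_class_def)

lemma card_residue_class_le_1:
  assumes "s < q" "n \<le> q"
  shows "card (residue_class n q s) \<le> 1"
  using assms by (cases "n = q") (simp_all add: card_residue_class)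

definition digit :: "nat \<Rightarrow> nat \<Rightarrow> nat \<Rightarrow> nat" where
  "digit k m v = v div k ^ m mod k"

lemma digit_less: "k > 0 \<Longrightarrow> digit k m v < k"
  by (simp add: digit_def)

lemma mod_power_Suc: "v mod k ^ Suc m = v mod k ^ m + k ^ m * digit k m v"
  by (simp add: digit_def mod_mult2_eq mult.commute[of k])

lemma digit_eq_if_mod_power_eq:
  assumes "v mod k ^ m = w mod k ^ m" "j < m" "k > 0"
  shows "digit k j v = digit k j w"
proof -
  have power_dvd: "k ^ i dvd k ^ m" if "i \<le> m" for i using that by (rule le_imp_power_dvd)
  have "v mod k ^ i = w mod k ^ i" if "i \<le> m" for i
    using assms(1) mod_mod_cancel[OF power_dvd[OF that]] by metis
  from this[of j] this[of "Suc j"] show ?thesis using assms by (simp only: mod_power_Suc) simp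
qed

lemma ex_lowest_distinct_digit:
  assumes "v \<noteq> w" "k \<ge> 2"
  shows "\<exists>m. v mod k ^ m = w mod k ^ m \<and> digit k m v \<noteq> digit k m w"
proof -
  define M where "M = Suc (v + w)"
  have "M < k ^ M" using assms(2) by (intro power_gt_expt) auto
  then have "v mod k ^ M \<noteq> w mod k ^ M" using assms(1) by (simp add: M_def)
  then obtain m where "v mod k ^ m = w mod k ^ m" "v mod k ^ Suc m \<noteq> w mod k ^ Suc m"
    using ex_least_nat_less[of "\<lambda>m. v mod k ^ m \<noteq> w mod k ^ m" M] by auto
  then show ?thesis by (metis mod_power_Suc)
qed

lemma residue_class_power_Suc:
  assumes "s < k ^ m" "k > 0"
  shows "{v \<in> residue_class n (k ^ m) s. digit k m v = c}
      = residue_class n (k ^ Suc m) (s + k ^ m * c)"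
proof -
  have "v mod k ^ m = s \<and> digit k m v = c" if eq: "v mod k ^ Suc m = s + k ^ m * c" for v
  proof
    have "(v mod k ^ m + k ^ m * digit k m v) mod k ^ m = (s + k ^ m * c) mod k ^ m"
      using eq by (simp only: mod_power_Suc)
    then show "v mod k ^ m = s" using assms by simp
    then show "digit k m v = c" using eq assms by (simp only: mod_power_Suc) simp
  qed
  then show ?thesis by (auto simp: residue_class_def mod_power_Suc simp del: power_Suc)
qed

text \<open>Each edge takes its color from the lowest base \<open>num_verts F\<close> digit in which its ends differ, so
  the blow-up refines residue classes modulo the powers of \<open>num_verts F\<close>. The map \<open>h\<close> labels the
  vertices of \<open>F\<close> by digits.\<close>

definition digit_color :: "('a, 't) cgraph \<Rightarrow> (nat \<Rightarrow> 'a) \<Rightarrow> nat set \<Rightarrow> 't" where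
  "digit_color F h e =
     (let m = LEAST m. \<not> is_singleton (digit (num_verts F) m ` e)
      in color F ((\<lambda>v. h (digit (num_verts F) m v)) ` e))"

lemma digit_color_eq:
  assumes "v mod num_verts F ^ m = w mod num_verts F ^ m"
    and "digit (num_verts F) m v \<noteq> digit (num_verts F) m w" and "num_verts F > 0"
  shows "digit_color F h {v, w}
      = color F {h (digit (num_verts F) m v), h (digit (num_verts F) m w)}"
proof -
  have "(LEAST m. \<not> is_singleton (digit (num_verts F) m ` {v, w})) = m"
  proof (rule Least_equality)
    show "\<not> is_singleton (digit (num_verts F) m ` {v, w})"
      using assms(2) by (auto simp: is_singleton_def)
    show "m \<le> j" if "\<not> is_singleton (digit (num_verts F) j ` {v, w})" for j
      using that digit_eq_if_mod_power_eq[OF assms(1) _ assms(3), of j] by (cases "m \<le> j") auto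
  qed
  then show ?thesis by (simp add: digit_color_def)
qed

lemma colored_complete_digit_color:
  assumes pattern: "colored_complete T F" "num_verts F \<ge> 2"
    and h_bij: "bij_betw h {..<num_verts F} (verts F)"
    and "finite U"
  shows "colored_complete T \<lparr>verts = U, color = digit_color F h\<rparr>"
proof -
  have "digit_color F h e \<in> T" if e: "e \<in> nsets U 2" for e
  proof -
    obtain v w where vw: "e = {v, w}" "v \<noteq> w" using e by (auto simp: nsets_2_eq)
    obtain m where lowest: "v mod num_verts F ^ m = w mod num_verts F ^ m"
      "digit (num_verts F) m v \<noteq> digit (num_verts F) m w"
      using ex_lowest_distinct_digit[OF vw(2) pattern(2)] by blast
    have "digit (num_verts F) m u \<in> {..<num_verts F}" for u
      using pattern(2) by (simp add: digit_less)
    then have "{h (digit (num_verts F) m v), h (digit (num_verts F) m w)} \<in> edges F"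
      using h_bij lowest(2) by (auto simp: bij_betw_def inj_on_eq_iff)
    then show ?thesis
      using pattern digit_color_eq[OF lowest] by (auto simp: vw(1) colored_complete_def)
  qed
  then show ?thesis using assms(4) by (simp add: colored_complete_def edges_def)
qed

lemma ex_residue_class_eq_fiber_digit:
  assumes h_bij: "bij_betw h {..<k} K" and "i \<in> K" "s < k ^ m" "k > 0"
  shows "\<exists>t<k ^ Suc m. fiber (\<lambda>v. h (digit k m v)) (residue_class n (k ^ m) s) i
      = residue_class n (k ^ Suc m) t"
proof -
  obtain c where i_eq: "c < k" "i = h c" using h_bij \<open>i \<in> K\<close> by (auto simp: bij_betw_def)
  have "digit k m v \<in> {..<k}" for v using \<open>k > 0\<close> by (simp add: digit_less)
  then have "h (digit k m v) = i \<longleftrightarrow> digit k m v = c" for v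
    using h_bij i_eq by (auto simp: bij_betw_def inj_on_eq_iff)
  then have "fiber (\<lambda>v. h (digit k m v)) (residue_class n (k ^ m) s) i
      = residue_class n (k ^ Suc m) (s + k ^ m * c)"
    using residue_class_power_Suc[OF assms(3,4), of n c] by (simp add: fiber_def)
  moreover have "s + k ^ m * c < k ^ m * Suc c" using assms(3) by simp
  then have "s + k ^ m * c < k ^ Suc m"
    using mult_le_mono2[of "Suc c" k "k ^ m"] i_eq(1) by (simp only: power_Suc2) linarith
  ultimately show ?thesis by blast
qed

lemma iterated_blowup_residue_class:
  assumes pattern: "colored_complete T F" "num_verts F \<ge> 2"
    and h_bij: "bij_betw h {..<num_verts F} (verts F)"
    and "s < num_verts F ^ m"
  shows "iterated_blowup T F \<lparr>verts = residue_class n (num_verts F ^ m) s, color = digit_color F h\<rparr>"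
  using assms(4)
proof (induction "n - m" arbitrary: m s rule: less_induct)
  case less
  let ?k = "num_verts F"
  let ?U = "residue_class n (?k ^ m) s"
  let ?G = "\<lparr>verts = ?U, color = digit_color F h\<rparr>"
  have complete: "colored_complete T ?G"
    using pattern h_bij by (intro colored_complete_digit_color) auto
  show ?case
  proof (cases "card ?U < ?k")
    case True
    then show ?thesis using complete by (intro iterated_blowup.small) (simp_all add: num_verts_def)
  next
    case False
    have "n > m"
      using False pattern(2) power_gt_expt[of ?k m] card_residue_class_le_1[OF less.prems, of n]
      by linarith
    define V where "V = fiber (\<lambda>v. h (digit ?k m v)) ?U"
    obtain t where part: "V i = residue_class n (?k ^ Suc m) (t i)" "t i < ?k ^ Suc m"
      if "i \<in> verts F" for i
      using ex_residue_class_eq_fiber_digit[OF h_bij _ less.prems, of _ n] pattern(2)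
      unfolding V_def by (metis less_le_trans pos2)
    have label: "h (digit ?k m v) \<in> verts F" for v
      using pattern(2) bij_betwE[OF h_bij] by (simp add: digit_less)
    show ?thesis
    proof (rule iterated_blowup.blowup[where V = V])
      show "?k \<le> num_verts ?G" using False by (simp add: num_verts_def)
      show "verts ?G = (\<Union>i\<in>verts F. V i)" using label by (auto simp: V_def fiber_def)
      show "disjoint_family_on V (verts F)" by (auto simp: disjoint_family_on_def V_def fiber_def)
      show "\<forall>i\<in>verts F. \<forall>j\<in>verts F. \<bar>int (card (V i)) - int (card (V j))\<bar> \<le> 1"
        using part by (simp add: card_residue_class)
      show "\<forall>i\<in>verts F. iterated_blowup T F (induced ?G (V i))"
        using less.hyps[of "Suc m"] part \<open>n > m\<close> by (auto simp: induced_def simp del: power_Suc)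
      show "\<forall>i\<in>verts F. \<forall>j\<in>verts F. i \<noteq> j \<longrightarrow> (\<forall>v\<in>V i. \<forall>w\<in>V j. color ?G {v, w} = color F {i, j})"
        using pattern(2) by (auto simp: V_def fiber_def residue_class_def intro!: digit_color_eq)
    qed (rule complete)
  qed
qed

lemma ex_iterated_blowup:
  assumes "colored_complete T F" "num_verts F \<ge> 2"
  shows "\<exists>G :: (nat, 't) cgraph. iterated_blowup T F G \<and> num_verts G = n"
proof -
  have "finite (verts F)" using assms(1) by (simp add: colored_complete_def)
  then obtain h where "bij_betw h {..<num_verts F} (verts F)"
    unfolding num_verts_def using ex_bij_betw_nat_finite by (auto simp: lessThan_atLeast0)
  then have "iterated_blowup T F
      \<lparr>verts = residue_class n (num_verts F ^ 0) 0, color = digit_color F h\<rparr>"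
    using assms by (intro iterated_blowup_residue_class) auto
  moreover have "residue_class n (num_verts F ^ 0) 0 = {..<n}" by (auto simp: residue_class_def)
  ultimately have "iterated_blowup T F \<lparr>verts = {..<n}, color = digit_color F h\<rparr>" by simp
  moreover have "num_verts \<lparr>verts = {..<n}, color = digit_color F h\<rparr> = n"
    by (simp add: num_verts_def)
  ultimately show ?thesis by blast
qed

section \<open>Limits\<close>

lemma power_div_binomial_tendsto: "(\<lambda>n. real n ^ k / real (n choose k)) \<longlonglongrightarrow> fact k"
proof -
  have "(\<lambda>n. \<Prod>i=0..<k. 1 - real i / real n) \<longlonglongrightarrow> (\<Prod>i=0..<k. 1 - 0)"
    by (intro tendsto_prod tendsto_diff tendsto_const lim_const_over_n)
  then have "(\<lambda>n. fact k / (\<Prod>i=0..<k. 1 - real i / real n)) \<longlonglongrightarrow> fact k / 1"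
    by (intro tendsto_divide tendsto_const) auto
  moreover have "\<forall>\<^sub>F n in sequentially. fact k / (\<Prod>i=0..<k. 1 - real i / real n)
      = real n ^ k / real (n choose k)"
    using eventually_gt_at_top[of 0]
  proof eventually_elim
    case (elim n)
    have "(\<Prod>i=0..<k. 1 - real i / real n) = (\<Prod>i=0..<k. (real n - real i) / real n)"
      using elim by (intro prod.cong) (auto simp: field_simps)
    also have "\<dots> = (\<Prod>i=0..<k. real n - real i) / real n ^ k" by (simp add: prod_dividef)
    also have "(\<Prod>i=0..<k. real n - real i) = fact k * real (n choose k)"
      by (simp add: binomial_gbinomial gbinomial_mult_fact)
    finally show ?case by simp
  qed
  ultimately show ?thesis by (simp add: tendsto_cong)
qed

lemma lower_power_div_binomial_tendsto_0:
  assumes "j < k"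
  shows "(\<lambda>n. real n ^ j / real (n choose k)) \<longlonglongrightarrow> 0"
proof -
  have "(\<lambda>n. real n ^ k / real (n choose k) * inverse (real n) ^ (k - j)) \<longlonglongrightarrow> fact k * 0 ^ (k - j)"
    by (intro tendsto_mult power_div_binomial_tendsto tendsto_power lim_inverse_n)
  moreover have "\<forall>\<^sub>F n in sequentially.
      real n ^ k / real (n choose k) * inverse (real n) ^ (k - j) = real n ^ j / real (n choose k)"
    using eventually_gt_at_top[of 0]
  proof eventually_elim
    case (elim n)
    have "real n ^ k = real n ^ j * real n ^ (k - j)" using assms by (simp flip: power_add)
    then show ?case using elim by (simp add: power_inverse field_simps)
  qed
  ultimately have "(\<lambda>n. real n ^ j / real (n choose k)) \<longlonglongrightarrow> fact k * 0 ^ (k - j)"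
    by (rule Lim_transform_eventually)
  then show ?thesis using assms by (simp add: zero_power)
qed

lemma fractal_bound_div_binomial_tendsto:
  "(\<lambda>n. fractal_bound k (real n) / real (n choose k)) \<longlonglongrightarrow> fact k / (real k ^ k - real k)"
  using tendsto_mult[OF power_div_binomial_tendsto[of k]
      tendsto_const[of "1 / (real k ^ k - real k)"]]
  by (simp add: fractal_bound_def mult.commute)

section \<open>Inducibility\<close>

lemma copies_le_binomial: "finite (verts G) \<Longrightarrow> copies F G \<le> num_verts G choose num_verts F"
  unfolding copies_def num_verts_def card_nsets[symmetric]
  by (intro card_mono) (auto simp: finite_imp_finite_nsets)

lemma iterated_blowup_colored_complete: "iterated_blowup T F G \<Longrightarrow> colored_complete T G"
  by (erule iterated_blowup.cases) auto

lemma finite_copies: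
  "finite {copies F G |G :: (nat, 't) cgraph. colored_complete T G \<and> num_verts G = n}"
  by (rule finite_subset[of _ "{..n choose num_verts F}"])
    (auto simp: colored_complete_def copies_le_binomial)

lemma copies_le_max_copies:
  fixes G :: "(nat, 't) cgraph"
  assumes "colored_complete T G"
  shows "copies F G \<le> max_copies T F (num_verts G)"
  unfolding max_copies_def using assms by (intro Max_ge finite_copies) auto

lemma max_copies_attained:
  assumes "colored_complete T F" "num_verts F \<ge> 2"
  obtains G :: "(nat, 't) cgraph"
  where "colored_complete T G" "num_verts G = n" "copies F G = max_copies T F n"
proof -
  have "{copies F G |G :: (nat, 't) cgraph. colored_complete T G \<and> num_verts G = n} \<noteq> {}"
    using ex_iterated_blowup[OF assms] iterated_blowup_colored_complete by fast
  then have "max_copies T F n \<in>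
      {copies F G |G :: (nat, 't) cgraph. colored_complete T G \<and> num_verts G = n}"
    unfolding max_copies_def by (intro Max_in finite_copies)
  then show ?thesis using that by auto
qed

definition max_blowup_density :: "'t set \<Rightarrow> ('a, 't) cgraph \<Rightarrow> nat \<Rightarrow> real" where
  "max_blowup_density T F n =
     Max {copy_density F G |G :: (nat, 't) cgraph. iterated_blowup T F G \<and> num_verts G = n}"

lemma max_blowup_density_attained:
  assumes "colored_complete T F" "num_verts F \<ge> 2"
  obtains G :: "(nat, 't) cgraph"
  where "iterated_blowup T F G" "num_verts G = n" "copy_density F G = max_blowup_density T F n"
proof -
  let ?Y = "{copy_density F G |G :: (nat, 't) cgraph. iterated_blowup T F G \<and> num_verts G = n}"
  have "?Y \<subseteq> (\<lambda>c. real c / real (n choose num_verts F)) `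
      {copies F G |G :: (nat, 't) cgraph. colored_complete T G \<and> num_verts G = n}"
    using iterated_blowup_colored_complete by (fastforce simp: copy_density_def)
  then have "finite ?Y" by (rule finite_subset) (intro finite_imageI finite_copies)
  moreover have "?Y \<noteq> {}" using ex_iterated_blowup[OF assms] by fast
  ultimately have "max_blowup_density T F n \<in> ?Y"
    unfolding max_blowup_density_def by (rule Max_in)
  then show ?thesis using that by auto
qed

context
  fixes T :: "'t set" and F :: "('a, 't) cgraph" and U L :: "nat \<Rightarrow> real"
  assumes pattern: "colored_complete T F" "num_verts F \<ge> 2"
    and upper: "\<And>G :: (nat, 't) cgraph. colored_complete T G \<Longrightarrow> copies F G \<le> U (num_verts G)"
    and lower: "\<And>G :: (nat, 't) cgraph. iterated_blowup T F G \<Longrightarrow> L (num_verts G) \<le> copies F G"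
begin

lemma max_copies_between: "L n \<le> max_copies T F n" "max_copies T F n \<le> U n"
proof -
  obtain H :: "(nat, 't) cgraph" where blowup: "iterated_blowup T F H" "num_verts H = n"
    using ex_iterated_blowup[OF pattern] by blast
  then show "L n \<le> max_copies T F n"
    using lower[OF blowup(1)]
      copies_le_max_copies[OF iterated_blowup_colored_complete[OF blowup(1)], of F]
    by simp
  obtain G :: "(nat, 't) cgraph"
    where "colored_complete T G" "num_verts G = n" "copies F G = max_copies T F n"
    using max_copies_attained[OF pattern] .
  then show "max_copies T F n \<le> U n" using upper by metis
qed

lemma max_blowup_density_between:
  "L n / real (n choose num_verts F) \<le> max_blowup_density T F n"
  "max_blowup_density T F n \<le> U n / real (n choose num_verts F)"
proof -
  obtain G :: "(nat, 't) cgraph" where blowup: "iterated_blowup T F G" "num_verts G = n"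
    and density: "copy_density F G = max_blowup_density T F n"
    using max_blowup_density_attained[OF pattern] .
  show "L n / real (n choose num_verts F) \<le> max_blowup_density T F n"
    using lower[OF blowup(1)]
    by (simp add: copy_density_def divide_right_mono blowup(2) flip: density)
  show "max_blowup_density T F n \<le> U n / real (n choose num_verts F)"
    using upper[OF iterated_blowup_colored_complete[OF blowup(1)]]
    by (simp add: copy_density_def divide_right_mono blowup(2) flip: density)
qed

lemma fractalizer_and_inducibility_eqI:
  assumes lim_upper: "(\<lambda>n. U n / real (n choose num_verts F)) \<longlonglongrightarrow> d"
    and lim_lower: "(\<lambda>n. L n / real (n choose num_verts F)) \<longlonglongrightarrow> d"
  shows "fractalizer T F \<and> inducibility T F = d"
proof -
  note sandwich = tendsto_sandwich[OF _ _ lim_lower lim_upper]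
  have "ind_n T F \<longlonglongrightarrow> d"
    unfolding ind_n_def using max_copies_between
    by (intro sandwich always_eventually allI divide_right_mono) auto
  then have "inducibility T F = d" by (simp add: inducibility_def limI)
  moreover have "max_blowup_density T F \<longlonglongrightarrow> d"
    using max_blowup_density_between by (intro sandwich always_eventually allI)
  ultimately show ?thesis by (simp add: fractalizer_def max_blowup_density_def[abs_def])
qed

end

theorem theorem1p2:
  fixes T :: "'t set" and R :: "('a, 't) cgraph" and k :: nat
  assumes "k \<ge> 11"
    and "colored_complete T R"
    and "num_verts R = k"
    and "rainbow R"
  shows "fractalizer T R \<and> inducibility T R = fact k / (real k ^ k - real k)"
proof (rule fractalizer_and_inducibility_eqI)
  have finite_R: "finite (verts R)" using assms(2) by (simp add: colored_complete_def)
  then have "large_rainbow_clique R"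
    using assms by unfold_locales (simp_all add: num_verts_def)
  then show "copies R G \<le> fractal_bound k (num_verts G)"
    if "colored_complete T G" for G :: "(nat, 't) cgraph"
    using large_rainbow_clique.copies_le_fractal_bound that assms(3) by (metis colored_complete_def)
  show "fractal_bound k (num_verts G) - real (num_verts G) ^ (k - 1) \<le> copies R G"
    if "iterated_blowup T R G" for G :: "(nat, 't) cgraph"
    using copies_iterated_blowup_ge[OF finite_R _ that] assms(1,3) by simp
  show bound_limit: "(\<lambda>n. fractal_bound k n / real (n choose num_verts R))
      \<longlonglongrightarrow> fact k / (real k ^ k - real k)"
    unfolding assms(3) by (rule fractal_bound_div_binomial_tendsto)
  show "(\<lambda>n. (fractal_bound k n - real n ^ (k - 1)) / real (n choose num_verts R))
      \<longlonglongrightarrow> fact k / (real k ^ k - real k)"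
    using tendsto_diff[OF bound_limit lower_power_div_binomial_tendsto_0[of "k - 1" k]] assms(1,3)
    by (simp add: diff_divide_distrib)
qed (use assms in simp_all)

end
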